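(* Every ordered abelian group whose complete theory is strong has bounded regular rank.
   Context: An ordered abelian group (OAG) is considered in the language $\{+,-,0,\le\}$. For $n\ge2$, an OAG $H$ is $n$-regular if $H/C$ is $n$-divisible for every convex subgroup $C\neq\{0\}$ of $H$. For $g\in G\setminus\{0\}$, $B(g)$ is the smallest convex subgroup containing $g$ and $A_n(g)$ is the smallest convex subgroup $C\subseteq B(g)$ with $B(g)/C$ $n$-regular. $\mathrm{RJ}_n(G)=\{A_n(g):g\ne0\}$; $G$ has bounded regular rank if $\mathrm{RJ}_p(G)$ is finite for every prime $p$. In a monster model of a complete theory $T$, an inp-pattern of depth $\kappa$ for a partial type $p(\bar x)$ consists of formulas $(\varphi_i(\bar x,\bar y_i))_{i<\kappa}$, natural numbers $(k_i)$ and an array $(\bar a^i_j: i<\kappa, j\in O)$, $O$ infinite linearly ordered, such that for every $f\in O^\kappa$, $p(\bar x)\cup\{\varphi_i(\bar x,\bar a^i_{f(i)})\}_i$ is consistent and each row $\{\varphi_i(\bar x,\bar a^i_j):j\in O\}$ is $k_i$-inconsistent. $T$ is strong if there is no inp-pattern of infinite depth for $\bar x=\bar x$ with $\bar x$ finite. *)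

theory Defs
  imports "HOL-Algebra.Coset" "HOL-Computational_Algebra.Primes"
begin

unbundle cardinal_syntax

section \<open>Ordered abelian groups\<close>

text \<open>Groups follow the multiplicative convention of HOL-Algebra: the group operation \<open>+\<close>, the
  element \<open>0\<close>, the inverse \<open>-\<close> and the multiple \<open>n x\<close> of the additive notation appear as \<open>\<otimes>\<close>,
  \<open>\<one>\<close>, \<open>inv\<close> and \<open>[^]\<close>.\<close>

record 'a ord_monoid = "'a monoid" +
  oleq :: "'a \<Rightarrow> 'a \<Rightarrow> bool" (infix "\<preceq>\<index>" 50)

locale oag = comm_group G for G :: "'a ord_monoid" (structure) +
  assumes oleq_refl: "x \<in> carrier G \<Longrightarrow> x \<preceq> x"
    and oleq_antisym:
      "\<lbrakk>x \<in> carrier G; y \<in> carrier G; x \<preceq> y; y \<preceq> x\<rbrakk> \<Longrightarrow> x = y"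
    and oleq_trans:
      "\<lbrakk>x \<in> carrier G; y \<in> carrier G; z \<in> carrier G; x \<preceq> y; y \<preceq> z\<rbrakk> \<Longrightarrow> x \<preceq> z"
    and oleq_total: "\<lbrakk>x \<in> carrier G; y \<in> carrier G\<rbrakk> \<Longrightarrow> x \<preceq> y \<or> y \<preceq> x"
    and oleq_mult_mono:
      "\<lbrakk>x \<in> carrier G; y \<in> carrier G; z \<in> carrier G; x \<preceq> y\<rbrakk> \<Longrightarrow> z \<otimes> x \<preceq> z \<otimes> y"

definition convex_subgroup :: "'a set \<Rightarrow> 'a ord_monoid \<Rightarrow> bool" where
  "convex_subgroup C G \<longleftrightarrow> subgroup C G \<and>
     (\<forall>x\<in>C. \<forall>y\<in>C. \<forall>z\<in>carrier G. x \<preceq>\<^bsub>G\<^esub> z \<and> z \<preceq>\<^bsub>G\<^esub> y \<longrightarrow> z \<in> C)"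

text \<open>The quotient by a convex subgroup, with the order induced by the projection.\<close>

definition oag_quot :: "'a ord_monoid \<Rightarrow> 'a set \<Rightarrow> 'a set ord_monoid" where
  "oag_quot G C =
     \<lparr>carrier = carrier (G Mod C), monoid.mult = monoid.mult (G Mod C), one = one (G Mod C),
      oleq = (\<lambda>X Y. \<exists>x\<in>X. \<exists>y\<in>Y. x \<preceq>\<^bsub>G\<^esub> y)\<rparr>"

definition n_divisible :: "nat \<Rightarrow> ('a, 'b) monoid_scheme \<Rightarrow> bool" where
  "n_divisible n H \<longleftrightarrow> (\<forall>x\<in>carrier H. \<exists>y\<in>carrier H. y [^]\<^bsub>H\<^esub> n = x)"

definition n_regular :: "nat \<Rightarrow> 'a ord_monoid \<Rightarrow> bool" where
  "n_regular n H \<longleftrightarrow>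
     (\<forall>C. convex_subgroup C H \<and> C \<noteq> {\<one>\<^bsub>H\<^esub>} \<longrightarrow> n_divisible n (oag_quot H C))"

definition B_conv :: "'a ord_monoid \<Rightarrow> 'a \<Rightarrow> 'a set" where
  "B_conv G g = (LEAST C. convex_subgroup C G \<and> g \<in> C)"

definition A_conv :: "'a ord_monoid \<Rightarrow> nat \<Rightarrow> 'a \<Rightarrow> 'a set" where
  "A_conv G n g =
     (LEAST C. convex_subgroup C G \<and> C \<subseteq> B_conv G g \<and>
               n_regular n (oag_quot (G\<lparr>carrier := B_conv G g\<rparr>) C))"

definition RJ :: "nat \<Rightarrow> 'a ord_monoid \<Rightarrow> 'a set set" where
  "RJ n G = {A_conv G n g | g. g \<in> carrier G \<and> g \<noteq> \<one>\<^bsub>G\<^esub>}"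

definition bounded_regular_rank :: "'a ord_monoid \<Rightarrow> bool" where
  "bounded_regular_rank G \<longleftrightarrow> (\<forall>p. prime p \<longrightarrow> finite (RJ p G))"


section \<open>First-order logic in the language of ordered abelian groups\<close>

datatype tm = Var nat | Zero | Plus tm tm | Minus tm

datatype fm = Eq tm tm | Le tm tm | Neg fm | Conj fm fm | Exi nat fm

primrec tm_vars :: "tm \<Rightarrow> nat set" where
  "tm_vars (Var k) = {k}"
| "tm_vars Zero = {}"
| "tm_vars (Plus s t) = tm_vars s \<union> tm_vars t"
| "tm_vars (Minus t) = tm_vars t"

primrec fv :: "fm \<Rightarrow> nat set" where
  "fv (Eq s t) = tm_vars s \<union> tm_vars t"
| "fv (Le s t) = tm_vars s \<union> tm_vars t"
| "fv (Neg \<phi>) = fv \<phi>"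
| "fv (Conj \<phi> \<psi>) = fv \<phi> \<union> fv \<psi>"
| "fv (Exi k \<phi>) = fv \<phi> - {k}"

primrec tm_val :: "'a ord_monoid \<Rightarrow> (nat \<Rightarrow> 'a) \<Rightarrow> tm \<Rightarrow> 'a" where
  "tm_val M v (Var k) = v k"
| "tm_val M v Zero = \<one>\<^bsub>M\<^esub>"
| "tm_val M v (Plus s t) = tm_val M v s \<otimes>\<^bsub>M\<^esub> tm_val M v t"
| "tm_val M v (Minus t) = inv\<^bsub>M\<^esub> (tm_val M v t)"

primrec sat :: "'a ord_monoid \<Rightarrow> (nat \<Rightarrow> 'a) \<Rightarrow> fm \<Rightarrow> bool" where
  "sat M v (Eq s t) \<longleftrightarrow> tm_val M v s = tm_val M v t"
| "sat M v (Le s t) \<longleftrightarrow> tm_val M v s \<preceq>\<^bsub>M\<^esub> tm_val M v t"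
| "sat M v (Neg \<phi>) \<longleftrightarrow> \<not> sat M v \<phi>"
| "sat M v (Conj \<phi> \<psi>) \<longleftrightarrow> sat M v \<phi> \<and> sat M v \<psi>"
| "sat M v (Exi k \<phi>) \<longleftrightarrow> (\<exists>a\<in>carrier M. sat M (v(k := a)) \<phi>)"

definition sentence_true :: "'a ord_monoid \<Rightarrow> fm \<Rightarrow> bool" where
  "sentence_true M \<phi> \<longleftrightarrow> (\<forall>v. range v \<subseteq> carrier M \<longrightarrow> sat M v \<phi>)"

definition Th :: "'a ord_monoid \<Rightarrow> fm set" where
  "Th G = {\<phi>. fv \<phi> = {} \<and> sentence_true G \<phi>}"

text \<open>All theories of interest contain the axioms of ordered abelian groups, so requiring \<open>oag M\<close>
  only says that \<open>M\<close> is a structure in which the function symbols are interpreted properly.\<close>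

definition models :: "'a ord_monoid \<Rightarrow> fm set \<Rightarrow> bool" where
  "models M T \<longleftrightarrow> oag M \<and> (\<forall>\<phi>\<in>T. sentence_true M \<phi>)"


section \<open>Partial types and monster models\<close>

text \<open>A formula \<open>\<phi>(x,a)\<close> with a tuple \<open>x\<close> of \<open>n\<close> variables and parameters \<open>a\<close> is the pair
  \<open>(\<phi>, a)\<close>, where the variables of \<open>\<phi>\<close> with indices below \<open>n\<close> stand for \<open>x\<close>, and those with
  indices \<open>n\<close>, \<open>n + 1\<close>, ... for the entries of the list \<open>a\<close>.\<close>

type_synonym 'a inst = "fm \<times> 'a list"

definition inst_over :: "'a set \<Rightarrow> nat \<Rightarrow> 'a inst \<Rightarrow> bool" where
  "inst_over A n \<theta> \<longleftrightarrow> fv (fst \<theta>) \<subseteq> {..<n + length (snd \<theta>)} \<and> set (snd \<theta>) \<subseteq> A"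

definition realizes :: "'a ord_monoid \<Rightarrow> 'a list \<Rightarrow> 'a inst set \<Rightarrow> bool" where
  "realizes M xs \<Gamma> \<longleftrightarrow> (\<forall>(\<phi>, as)\<in>\<Gamma>. sat M (nth (xs @ as)) \<phi>)"

text \<open>Consistency of a set of formulas with parameters in \<open>M\<close> means finite satisfiability in
  \<open>M\<close>, i.e. consistency with the elementary diagram of \<open>M\<close>.\<close>

definition consistent :: "'a ord_monoid \<Rightarrow> nat \<Rightarrow> 'a inst set \<Rightarrow> bool" where
  "consistent M n \<Gamma> \<longleftrightarrow>
     (\<forall>\<Delta>. \<Delta> \<subseteq> \<Gamma> \<and> finite \<Delta> \<longrightarrow>
        (\<exists>xs. length xs = n \<and> set xs \<subseteq> carrier M \<and> realizes M xs \<Delta>))"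

definition saturated :: "'k rel \<Rightarrow> 'a ord_monoid \<Rightarrow> bool" where
  "saturated \<kappa> M \<longleftrightarrow>
     (\<forall>A n \<Gamma>. A \<subseteq> carrier M \<and> |A| <o \<kappa> \<and> (\<forall>\<theta>\<in>\<Gamma>. inst_over A n \<theta>) \<and> consistent M n \<Gamma> \<longrightarrow>
        (\<exists>xs. length xs = n \<and> set xs \<subseteq> carrier M \<and> realizes M xs \<Gamma>))"

definition partial_elementary :: "'a ord_monoid \<Rightarrow> 'a set \<Rightarrow> ('a \<Rightarrow> 'a) \<Rightarrow> bool" where
  "partial_elementary M A f \<longleftrightarrow>
     f ` A \<subseteq> carrier M \<and>
     (\<forall>\<phi> as. set as \<subseteq> A \<and> fv \<phi> \<subseteq> {..<length as} \<longrightarrow>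
        (sat M (nth as) \<phi> \<longleftrightarrow> sat M (nth (map f as)) \<phi>))"

definition oag_automorphism :: "'a ord_monoid \<Rightarrow> ('a \<Rightarrow> 'a) \<Rightarrow> bool" where
  "oag_automorphism M h \<longleftrightarrow>
     h \<in> iso M M \<and> (\<forall>x\<in>carrier M. \<forall>y\<in>carrier M. x \<preceq>\<^bsub>M\<^esub> y \<longleftrightarrow> h x \<preceq>\<^bsub>M\<^esub> h y)"

definition strongly_homogeneous :: "'k rel \<Rightarrow> 'a ord_monoid \<Rightarrow> bool" where
  "strongly_homogeneous \<kappa> M \<longleftrightarrow>
     (\<forall>A f. A \<subseteq> carrier M \<and> |A| <o \<kappa> \<and> partial_elementary M A f \<longrightarrow>
        (\<exists>h. oag_automorphism M h \<and> (\<forall>a\<in>A. h a = f a)))"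

text \<open>The language being countable, any uncountable cardinal \<open>\<kappa>\<close> is a large enough bound for
  smallness here (see also \<open>strong_imp_no_inp_pattern\<close> below).\<close>

definition monster_model :: "'k rel \<Rightarrow> 'a ord_monoid \<Rightarrow> fm set \<Rightarrow> bool" where
  "monster_model \<kappa> M T \<longleftrightarrow>
     Card_order \<kappa> \<and> natLeq <o \<kappa> \<and> models M T \<and> saturated \<kappa> M \<and> strongly_homogeneous \<kappa> M"


section \<open>Inp-patterns and strong theories\<close>

text \<open>The rows are indexed by \<open>I\<close>, so the depth is the cardinality of \<open>I\<close>, and the columns by the
  set \<open>O'\<close> linearly ordered by \<open>r\<close>; \<open>n\<close> is the length of the tuple \<open>x\<close>, and \<open>m i\<close> that of \<open>y\<^sub>i\<close>.
  As usual, \<open>k\<close>-inconsistency of a row refers to \<open>k\<close> distinct column indices, also if the row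
  repeats parameters.\<close>

definition inp_pattern ::
  "'a ord_monoid \<Rightarrow> nat \<Rightarrow> 'a inst set \<Rightarrow> 'i set \<Rightarrow> 'o set \<Rightarrow> 'o rel \<Rightarrow>
   ('i \<Rightarrow> nat) \<Rightarrow> ('i \<Rightarrow> fm) \<Rightarrow> ('i \<Rightarrow> nat) \<Rightarrow> ('i \<Rightarrow> 'o \<Rightarrow> 'a list) \<Rightarrow> bool" where
  "inp_pattern M n p I O' r m \<phi> k a \<longleftrightarrow>
     infinite O' \<and> linear_order_on O' r \<and>
     (\<forall>i\<in>I. fv (\<phi> i) \<subseteq> {..<n + m i}) \<and>
     (\<forall>i\<in>I. \<forall>j\<in>O'. length (a i j) = m i \<and> set (a i j) \<subseteq> carrier M) \<and>
     (\<forall>f\<in>I \<rightarrow> O'. consistent M n (p \<union> (\<lambda>i. (\<phi> i, a i (f i))) ` I)) \<and>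
     (\<forall>i\<in>I. \<forall>J. J \<subseteq> O' \<and> finite J \<and> card J = k i \<longrightarrow>
        \<not> consistent M n ((\<lambda>j. (\<phi> i, a i j)) ` J))"

definition trivial_type :: "nat \<Rightarrow> 'a inst set" where
  "trivial_type n = {(Eq (Var l) (Var l), []) | l. l < n}"

text \<open>Strongness of \<open>T\<close>, evaluated in a monster model \<open>M\<close> of \<open>T\<close>. Patterns with index sets in
  the type of natural numbers suffice: see the lemma \<open>strong_imp_no_inp_pattern\<close>.\<close>

definition strong :: "'a ord_monoid \<Rightarrow> bool" where
  "strong M \<longleftrightarrow>
     \<not> (\<exists>n (I :: nat set) (O' :: nat set) r m \<phi> k a.
          infinite I \<and> inp_pattern M n (trivial_type n) I O' r m \<phi> k a)"

lemma consistent_mono: "consistent M n \<Gamma> \<Longrightarrow> \<Gamma>' \<subseteq> \<Gamma> \<Longrightarrow> consistent M n \<Gamma>'"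
  unfolding consistent_def by blast

lemma inp_pattern_nat:
  fixes I :: "'i set" and O' :: "'o set"
  assumes I: "infinite I" and pat: "inp_pattern M n p I O' r m \<phi> k a"
  shows "\<exists>m' \<phi>' k' a'.
           inp_pattern M n p (UNIV :: nat set) (UNIV :: nat set) {(i, j). i \<le> j} m' \<phi>' k' a'"
proof -
  from pat have O': "infinite O'"
    and fv: "\<And>i. i \<in> I \<Longrightarrow> fv (\<phi> i) \<subseteq> {..<n + m i}"
    and par: "\<And>i j. i \<in> I \<Longrightarrow> j \<in> O' \<Longrightarrow> length (a i j) = m i \<and> set (a i j) \<subseteq> carrier M"
    and con: "\<And>f. f \<in> I \<rightarrow> O' \<Longrightarrow> consistent M n (p \<union> (\<lambda>i. (\<phi> i, a i (f i))) ` I)"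
    and inc: "\<And>i J. i \<in> I \<Longrightarrow> J \<subseteq> O' \<Longrightarrow> finite J \<Longrightarrow> card J = k i \<Longrightarrow>
                \<not> consistent M n ((\<lambda>j. (\<phi> i, a i j)) ` J)"
    unfolding inp_pattern_def by blast+
  obtain g :: "nat \<Rightarrow> 'i" where g: "inj g" "range g \<subseteq> I"
    using I infinite_countable_subset by blast
  obtain h :: "nat \<Rightarrow> 'o" where h: "inj h" "range h \<subseteq> O'"
    using O' infinite_countable_subset by blast
  have gI: "g i \<in> I" and hO: "h j \<in> O'" for i j
    using g h by auto
  have lin: "linear_order_on (UNIV :: nat set) {(i, j). i \<le> j}"
    by (auto simp: linear_order_on_def partial_order_on_def preorder_on_def
        refl_on_def trans_def antisym_def total_on_def)
  have con': "consistent M n (p \<union> range (\<lambda>i. (\<phi> (g i), a (g i) (h (f i)))))" for f :: "nat \<Rightarrow> nat"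
  proof (rule consistent_mono)
    let ?f = "\<lambda>i. h (f (inv_into UNIV g i))"
    show "consistent M n (p \<union> (\<lambda>i. (\<phi> i, a i (?f i))) ` I)"
      by (rule con) (use hO in auto)
    have "(\<phi> (g i), a (g i) (h (f i))) = (\<lambda>i. (\<phi> i, a i (?f i))) (g i)" for i
      using g by simp
    then show "p \<union> range (\<lambda>i. (\<phi> (g i), a (g i) (h (f i)))) \<subseteq> p \<union> (\<lambda>i. (\<phi> i, a i (?f i))) ` I"
      using gI by blast
  qed
  have inc': "\<not> consistent M n ((\<lambda>j. (\<phi> (g i), a (g i) (h j))) ` J)"
    if "finite J" "card J = k (g i)" for i J
  proof -
    have "card (h ` J) = k (g i)"
      using that h by (metis card_image inj_on_subset subset_UNIV)
    then have "\<not> consistent M n ((\<lambda>j. (\<phi> (g i), a (g i) j)) ` (h ` J))"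
      using inc[of "g i" "h ` J"] gI hO that by blast
    then show ?thesis by (simp add: image_image)
  qed
  have "inp_pattern M n p (UNIV :: nat set) (UNIV :: nat set) {(i, j). i \<le> j}
          (m \<circ> g) (\<phi> \<circ> g) (k \<circ> g) (\<lambda>i j. a (g i) (h j))"
    unfolding inp_pattern_def using lin con' inc' fv par gI hO by auto
  then show ?thesis by blast
qed

lemma strong_imp_no_inp_pattern:
  assumes "strong M" and "infinite I"
  shows "\<not> inp_pattern M n (trivial_type n) I O' r m \<phi> k a"
  using assms inp_pattern_nat[of I M n "trivial_type n" O' r m \<phi> k a]
  unfolding strong_def by (meson infinite_UNIV_nat)

end

theory Submission
  imports Defs
begin

text \<open>If \<open>RJ\<^sub>p(G)\<close> is infinite, then \<open>G\<close> contains arbitrarily long finite sequences of positive elements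
  with \<open>h\<^sub>t\<^sub>+\<^sub>1 \<notin> B(h\<^sub>t) + pG\<close>. This relation is definable, because \<open>x \<in> B(u) + qG\<close> holds iff
  \<open>0 \<le> x - qy \<le> qu\<close> for some \<open>y\<close>, so by saturation the monster model contains an array of such
  elements that is increasing along \<open>\<omega> \<times> \<omega>\<close> in the lexicographic order. The rows
  \<open>x \<in> B(c\<^sub>i\<^sub>,\<^sub>j\<^sub>+\<^sub>1) + p\<^sup>i\<^sup>+\<^sup>1G\<close>, \<open>x \<notin> B(c\<^sub>i\<^sub>,\<^sub>j) + p\<^sup>i\<^sup>+\<^sup>1G\<close> are 2-inconsistent, and
  \<open>\<Sum>\<^sub>i p\<^sup>i c\<^sub>i\<^sub>,\<^sub>f\<^sub>(\<^sub>i\<^sub>)\<^sub>+\<^sub>1\<close> satisfies the formulas chosen by \<open>f\<close> in the rows it sums over.\<close>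

section \<open>Convex subgroups\<close>

lemma convex_subgroup_subgroup: "convex_subgroup C G \<Longrightarrow> subgroup C G"
  by (simp add: convex_subgroup_def)

lemma convex_subgroup_convex:
  "\<lbrakk>convex_subgroup C G; x \<in> C; y \<in> C; z \<in> carrier G; x \<preceq>\<^bsub>G\<^esub> z; z \<preceq>\<^bsub>G\<^esub> y\<rbrakk> \<Longrightarrow> z \<in> C"
  unfolding convex_subgroup_def by blast

context oag
begin

text \<open>For \<open>\<one> \<preceq> u\<close> this is the convex subgroup generated by
  \<open>u\<close>, with explicit bounds in place of \<open>LEAST\<close>. For negative
  \<open>u\<close> it collapses to \<open>{\<one>}\<close>, so it is applied to nonnegative
  elements.\<close>

definition cspan :: "'a \<Rightarrow> 'a set" where
  "cspan u = {z \<in> carrier G. \<exists>n::nat. inv (u [^] n) \<preceq> z \<and> z \<preceq> u [^] n}"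

text \<open>In additive notation \<open>C + qG\<close>, written through a witness \<open>y\<close>
  for the summand in \<open>qG\<close>.\<close>

definition add_pow :: "nat \<Rightarrow> 'a set \<Rightarrow> 'a set" where
  "add_pow q C = {x \<in> carrier G. \<exists>y\<in>carrier G. x \<otimes> inv (y [^] q) \<in> C}"

section \<open>Order arithmetic\<close>

lemma oleq_mult:
  assumes "a \<in> carrier G" "b \<in> carrier G" "c \<in> carrier G" "d \<in> carrier G" "a \<preceq> b" "c \<preceq> d"
  shows "a \<otimes> c \<preceq> b \<otimes> d"
proof -
  have "a \<otimes> c \<preceq> a \<otimes> d" "d \<otimes> a \<preceq> d \<otimes> b"
    using assms by (simp_all add: oleq_mult_mono)
  then show ?thesis
    using assms oleq_trans[of "a \<otimes> c" "a \<otimes> d" "b \<otimes> d"] by (simp add: m_comm)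
qed

lemma oleq_inv:
  assumes "x \<in> carrier G" "y \<in> carrier G" "x \<preceq> y"
  shows "inv y \<preceq> inv x"
proof -
  have "(inv x \<otimes> inv y) \<otimes> x \<preceq> (inv x \<otimes> inv y) \<otimes> y"
    using assms by (simp add: oleq_mult_mono)
  moreover have "(inv x \<otimes> inv y) \<otimes> x = inv y"
    using assms by (simp add: m_comm[of "inv x" "inv y"] m_assoc)
  moreover have "(inv x \<otimes> inv y) \<otimes> y = inv x"
    using assms by (simp add: m_assoc)
  ultimately show ?thesis by simp
qed

lemma one_oleq_inv: "\<lbrakk>x \<in> carrier G; x \<preceq> \<one>\<rbrakk> \<Longrightarrow> \<one> \<preceq> inv x"
  using oleq_inv[of x \<one>] by simp

lemma one_oleq_pow: "\<lbrakk>u \<in> carrier G; \<one> \<preceq> u\<rbrakk> \<Longrightarrow> \<one> \<preceq> u [^] (n::nat)"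
proof (induction n)
  case (Suc n)
  then show ?case using oleq_mult[of \<one> "u [^] n" \<one> u] by simp
qed (simp add: oleq_refl)

lemma pow_oleq_pow:
  assumes "u \<in> carrier G" "\<one> \<preceq> u" "m \<le> (n::nat)"
  shows "u [^] m \<preceq> u [^] n"
proof -
  have "u [^] n = u [^] m \<otimes> u [^] (n - m)"
    using assms by (simp add: nat_pow_mult)
  moreover have "u [^] m \<otimes> \<one> \<preceq> u [^] m \<otimes> u [^] (n - m)"
    using assms by (intro oleq_mult_mono one_oleq_pow) auto
  ultimately show ?thesis using assms by simp
qed

lemma oleq_pow:
  assumes "u \<in> carrier G" "\<one> \<preceq> u" "n > 0"
  shows "u \<preceq> u [^] (n::nat)"
  using pow_oleq_pow[of u 1 n] assms by simp

section \<open>The convex subgroup generated by a nonnegative element\<close>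

lemma convex_cspan:
  assumes u: "u \<in> carrier G" "\<one> \<preceq> u"
  shows "convex_subgroup (cspan u) G"
  unfolding convex_subgroup_def
proof (intro conjI ballI impI)
  show "subgroup (cspan u) G"
  proof (rule subgroupI)
    have "\<one> \<in> cspan u"
      unfolding cspan_def using u by (auto intro!: exI[of _ 0] simp: oleq_refl)
    then show "cspan u \<noteq> {}" by blast
  next
    fix a assume "a \<in> cspan u"
    then obtain n :: nat where a: "a \<in> carrier G" "inv (u [^] n) \<preceq> a" "a \<preceq> u [^] n"
      unfolding cspan_def by blast
    then have "inv (u [^] n) \<preceq> inv a" "inv a \<preceq> inv (inv (u [^] n))"
      using u by (simp_all only: oleq_inv inv_closed nat_pow_closed)
    then show "inv a \<in> cspan u"
      unfolding cspan_def using u a by (auto intro!: exI[of _ n])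
  next
    fix a b assume "a \<in> cspan u" "b \<in> cspan u"
    then obtain m n :: nat where a: "a \<in> carrier G" "inv (u [^] m) \<preceq> a" "a \<preceq> u [^] m"
      and b: "b \<in> carrier G" "inv (u [^] n) \<preceq> b" "b \<preceq> u [^] n"
      unfolding cspan_def by blast
    have "inv (u [^] (m + n)) = inv (u [^] m) \<otimes> inv (u [^] n)"
      using u by (simp add: nat_pow_mult[symmetric] inv_mult)
    then have "inv (u [^] (m + n)) \<preceq> a \<otimes> b" "a \<otimes> b \<preceq> u [^] (m + n)"
      using a b u oleq_mult[of "inv (u [^] m)" a "inv (u [^] n)" b]
        oleq_mult[of a "u [^] m" b "u [^] n"] by (simp_all add: nat_pow_mult[symmetric])
    then show "a \<otimes> b \<in> cspan u"
      unfolding cspan_def using a b by auto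
  qed (auto simp: cspan_def)
  fix x y z assume x: "x \<in> cspan u" and y: "y \<in> cspan u" and z: "z \<in> carrier G"
    and "x \<preceq> z \<and> z \<preceq> y"
  then have xz: "x \<preceq> z" "z \<preceq> y" by auto
  obtain m n :: nat where xm: "x \<in> carrier G" "inv (u [^] m) \<preceq> x"
    and yn: "y \<in> carrier G" "y \<preceq> u [^] n"
    using x y unfolding cspan_def by blast
  have "inv (u [^] (m + n)) \<preceq> inv (u [^] m)" "u [^] n \<preceq> u [^] (m + n)"
    using u by (auto intro!: oleq_inv pow_oleq_pow)
  then have "inv (u [^] (m + n)) \<preceq> z" "z \<preceq> u [^] (m + n)"
    using xm yn xz z u by (meson inv_closed nat_pow_closed oleq_trans)+
  then show "z \<in> cspan u"
    unfolding cspan_def using z by auto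
qed

lemma cspan_self:
  assumes "u \<in> carrier G" "\<one> \<preceq> u"
  shows "u \<in> cspan u"
proof -
  have "inv u \<preceq> \<one>" using assms oleq_inv[of \<one> u] by simp
  then have "inv u \<preceq> u" using assms by (meson inv_closed oleq_trans one_closed)
  then show ?thesis
    unfolding cspan_def using assms by (auto intro!: exI[of _ 1] simp: oleq_refl)
qed

lemma cspan_least:
  assumes "convex_subgroup C G" "u \<in> C"
  shows "cspan u \<subseteq> C"
proof -
  interpret C: subgroup C G using assms by (simp add: convex_subgroup_def)
  have "u [^] (n::nat) \<in> C" for n
    by (induction n) (use assms in auto)
  then show ?thesis
    unfolding cspan_def using convex_subgroup_convex[OF assms(1)] by blast
qed

text \<open>If neither inclusion held, each subgroup would contain an element outside the other, and
  both may be taken nonnegative. The smaller of the two lies between \<open>\<one>\<close> and the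
  larger, so convexity places it in the wrong subgroup.\<close>

lemma convex_subgroup_linear:
  assumes C: "convex_subgroup C G" and D: "convex_subgroup D G"
  shows "C \<subseteq> D \<or> D \<subseteq> C"
proof (rule ccontr)
  interpret C: subgroup C G using C by (simp add: convex_subgroup_def)
  interpret D: subgroup D G using D by (simp add: convex_subgroup_def)
  assume "\<not> (C \<subseteq> D \<or> D \<subseteq> C)"
  then obtain c d where c: "c \<in> C" "c \<notin> D" and d: "d \<in> D" "d \<notin> C" by blast
  have "\<exists>c'. c' \<in> C \<and> c' \<notin> D \<and> \<one> \<preceq> c'"
    using c oleq_total[of \<one> c] one_oleq_inv[of c]
    by (metis C.mem_carrier C.m_inv_closed D.m_inv_closed inv_inv one_closed)
  then obtain c' where c': "c' \<in> C" "c' \<notin> D" "\<one> \<preceq> c'" by blast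
  have "\<exists>d'. d' \<in> D \<and> d' \<notin> C \<and> \<one> \<preceq> d'"
    using d oleq_total[of \<one> d] one_oleq_inv[of d]
    by (metis D.mem_carrier C.m_inv_closed D.m_inv_closed inv_inv one_closed)
  then obtain d' where d': "d' \<in> D" "d' \<notin> C" "\<one> \<preceq> d'" by blast
  have "c' \<preceq> d' \<or> d' \<preceq> c'"
    using oleq_total c' d' by simp
  then show False
    using convex_subgroup_convex[OF C C.one_closed c'(1), of d']
      convex_subgroup_convex[OF D D.one_closed d'(1), of c'] c' d' by auto
qed

text \<open>Serves to choose nonnegative generators for \<open>cspan\<close>. The last conclusion
  keeps \<open>d'\<close> in every subgroup that contains \<open>d\<close>.\<close>

lemma nonneg_outside:
  assumes "convex_subgroup C G" "d \<in> carrier G" "d \<notin> C"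
  obtains d' where "d' \<in> carrier G" "\<one> \<preceq> d'" "d' \<notin> C" "d' = d \<or> d' = inv d"
proof (cases "\<one> \<preceq> d")
  case False
  then have "\<one> \<preceq> inv d" using assms oleq_total[of \<one> d] one_oleq_inv by auto
  moreover have "inv d \<notin> C"
    using assms by (metis convex_subgroup_subgroup inv_inv subgroup.m_inv_closed)
  ultimately show ?thesis using that[of "inv d"] assms by auto
qed (use assms that in auto)

text \<open>After a change of sign the element lies between \<open>\<one>\<close> and its
  \<open>n\<close>-th power, and convexity applies. Quotients by convex subgroups are thus
  torsion-free, which later allows powers to be cancelled.\<close>

lemma convex_subgroup_pure:
  assumes C: "convex_subgroup C G" and a: "a \<in> carrier G" "a [^] (n::nat) \<in> C" and n: "n > 0"
  shows "a \<in> C"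
proof (rule ccontr)
  interpret C: subgroup C G using C by (simp add: convex_subgroup_def)
  assume "a \<notin> C"
  then obtain b where b: "b \<in> carrier G" "\<one> \<preceq> b" "b \<notin> C" "b = a \<or> b = inv a"
    using nonneg_outside[OF C a(1)] by blast
  have "b [^] n \<in> C"
    using b(4) a by (auto simp: nat_pow_inv)
  then show False
    using convex_subgroup_convex[OF C C.one_closed, of "b [^] n" b] b oleq_pow[of b n] n by auto
qed

lemma convex_subgroup_Inter:
  assumes "\<And>C. C \<in> \<C> \<Longrightarrow> convex_subgroup C G" "\<C> \<noteq> {}"
  shows "convex_subgroup (\<Inter>\<C>) G"
  unfolding convex_subgroup_def
proof (intro conjI ballI impI)
  show "subgroup (\<Inter>\<C>) G"
    using assms by (intro subgroups_Inter) (auto simp: convex_subgroup_def)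
  fix x y z assume "x \<in> \<Inter>\<C>" "y \<in> \<Inter>\<C>" "z \<in> carrier G" "x \<preceq> z \<and> z \<preceq> y"
  then show "z \<in> \<Inter>\<C>"
    using assms(1) convex_subgroup_convex by (metis Inter_iff)
qed

lemma convex_carrier: "convex_subgroup (carrier G) G"
  unfolding convex_subgroup_def using subgroup_self by auto

text \<open>Convex subgroups form a chain, so any two elements of the union lie in a common member,
  where closure and convexity can be checked.\<close>

lemma convex_subgroup_Union:
  assumes \<C>: "\<And>C. C \<in> \<C> \<Longrightarrow> convex_subgroup C G" and ne: "\<C> \<noteq> {}"
  shows "convex_subgroup (\<Union>\<C>) G"
proof -
  have dir: "\<exists>C\<in>\<C>. x \<in> C \<and> y \<in> C" if "x \<in> \<Union>\<C>" "y \<in> \<Union>\<C>" for x y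
    using that convex_subgroup_linear \<C> by (metis Union_iff subsetD)
  show ?thesis
    unfolding convex_subgroup_def
  proof (intro conjI ballI impI)
    show "subgroup (\<Union>\<C>) G"
    proof (rule subgroupI)
      show "\<Union>\<C> \<subseteq> carrier G"
        using \<C> by (auto simp: convex_subgroup_def dest: subgroup.mem_carrier)
      show "\<Union>\<C> \<noteq> {}"
        using \<C> ne by (metis Union_iff convex_subgroup_subgroup empty_iff ex_in_conv subgroup.one_closed)
    next
      fix a assume "a \<in> \<Union>\<C>"
      then show "inv a \<in> \<Union>\<C>"
        using \<C> by (metis Union_iff convex_subgroup_subgroup subgroup.m_inv_closed)
    next
      fix a b assume "a \<in> \<Union>\<C>" "b \<in> \<Union>\<C>"
      then show "a \<otimes> b \<in> \<Union>\<C>"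
        using \<C> dir[of a b] by (metis Union_iff convex_subgroup_subgroup subgroup.m_closed)
    qed
    fix x y z assume "x \<in> \<Union>\<C>" "y \<in> \<Union>\<C>" "z \<in> carrier G" "x \<preceq> z \<and> z \<preceq> y"
    then show "z \<in> \<Union>\<C>"
      using \<C> dir[of x y] convex_subgroup_convex by (metis Union_iff)
  qed
qed

lemma convex_one: "convex_subgroup {\<one>} G"
  unfolding convex_subgroup_def using triv_subgroup oleq_antisym by auto

lemma add_pow_mono: "C \<subseteq> D \<Longrightarrow> add_pow q C \<subseteq> add_pow q D"
  unfolding add_pow_def by blast

text \<open>The intersection of all convex subgroups containing \<open>g\<close> is itself one of
  them, so the \<open>LEAST\<close> in \<open>B_conv\<close> is attained.\<close>

lemma convex_B_conv:
  assumes "g \<in> carrier G"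
  shows "convex_subgroup (B_conv G g) G"
proof -
  let ?\<C> = "{C. convex_subgroup C G \<and> g \<in> C}"
  have *: "convex_subgroup (\<Inter>?\<C>) G"
    using convex_carrier assms by (intro convex_subgroup_Inter) auto
  have "B_conv G g = \<Inter>?\<C>"
    unfolding B_conv_def by (rule Least_equality) (use * in auto)
  then show ?thesis using * by simp
qed

text \<open>Division with remainder by \<open>u [^] q\<close>. The left side allows arbitrarily
  large multiples of \<open>u\<close>, which is not visibly first-order. Multiples of
  \<open>u [^] q\<close> are themselves \<open>q\<close>-th powers, so removing them brings the
  remainder into one fixed interval; the right side can then be expressed by a formula.\<close>

lemma mem_cspan_add_pow_iff:
  assumes u: "u \<in> carrier G" "\<one> \<preceq> u" and q: "q > 0" and x: "x \<in> carrier G"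
  shows "x \<in> add_pow q (cspan u) \<longleftrightarrow>
    (\<exists>y\<in>carrier G. \<one> \<preceq> x \<otimes> inv (y [^] q) \<and> x \<otimes> inv (y [^] q) \<preceq> u [^] q)"
proof
  assume "\<exists>y\<in>carrier G. \<one> \<preceq> x \<otimes> inv (y [^] q) \<and> x \<otimes> inv (y [^] q) \<preceq> u [^] q"
  then obtain y where y: "y \<in> carrier G" "\<one> \<preceq> x \<otimes> inv (y [^] q)"
    "x \<otimes> inv (y [^] q) \<preceq> u [^] q" by blast
  have "\<one> \<in> cspan u"
    using convex_cspan[OF u] by (simp add: convex_subgroup_def subgroup.one_closed)
  moreover have "u [^] q \<in> cspan u"
    unfolding cspan_def using u
    by (auto intro!: exI[of _ q] simp: oleq_refl)
      (metis inv_closed nat_pow_closed oleq_inv oleq_trans one_closed inv_one one_oleq_pow)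
  ultimately have "x \<otimes> inv (y [^] q) \<in> cspan u"
    using convex_subgroup_convex[OF convex_cspan[OF u], of \<one> "u [^] q"] x y by simp
  then show "x \<in> add_pow q (cspan u)"
    unfolding add_pow_def using x y by blast
next
  \<comment> \<open>Induction on a bound for the number of times that \<open>u [^] q\<close> has to
    be divided out. Each removal contributes one factor \<open>u\<close> to the final
    \<open>y\<close>.\<close>
  have reduce: "\<exists>y\<in>carrier G. \<one> \<preceq> z \<otimes> inv (y [^] q) \<and> z \<otimes> inv (y [^] q) \<preceq> u [^] q"
    if "z \<in> carrier G" "\<one> \<preceq> z" "z \<preceq> u [^] (q * n)" for n z
    using that
  proof (induction n arbitrary: z)
    case 0
    then show ?case
      using u oleq_antisym[of z \<one>] one_oleq_pow[of u q]
      by (intro bexI[of _ \<one>]) (auto simp: oleq_refl)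
  next
    case (Suc n)
    show ?case
    proof (cases "z \<preceq> u [^] q")
      case True
      then show ?thesis using Suc.prems by (intro bexI[of _ \<one>]) auto
    next
      case False
      let ?w = "z \<otimes> inv (u [^] q)"
      have "u [^] q \<preceq> z" using False oleq_total u Suc.prems by blast
      then have "\<one> \<preceq> ?w"
        using oleq_mult[of "u [^] q" z "inv (u [^] q)" "inv (u [^] q)"] u Suc.prems
        by (simp add: oleq_refl)
      moreover have "?w \<preceq> u [^] (q * n)"
      proof -
        have "u [^] (q * Suc n) \<otimes> inv (u [^] q) = u [^] (q * n)"
          using u by (simp add: nat_pow_mult[symmetric] m_comm[of "u [^] q"] m_assoc)
        then show ?thesis
          using oleq_mult[of z "u [^] (q * Suc n)" "inv (u [^] q)" "inv (u [^] q)"] u Suc.prems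
          by (simp add: oleq_refl)
      qed
      ultimately obtain y where y: "y \<in> carrier G" "\<one> \<preceq> ?w \<otimes> inv (y [^] q)"
        "?w \<otimes> inv (y [^] q) \<preceq> u [^] q"
        using Suc.IH[of ?w] Suc.prems u by auto
      have "?w \<otimes> inv (y [^] q) = z \<otimes> inv ((u \<otimes> y) [^] q)"
        using u y Suc.prems by (simp add: nat_pow_distrib inv_mult m_assoc)
      then show ?thesis using y u by (intro bexI[of _ "u \<otimes> y"]) auto
    qed
  qed
  assume "x \<in> add_pow q (cspan u)"
  then obtain y and n :: nat where y: "y \<in> carrier G"
    and n: "inv (u [^] n) \<preceq> x \<otimes> inv (y [^] q)" "x \<otimes> inv (y [^] q) \<preceq> u [^] n"
    unfolding add_pow_def cspan_def by blast
  let ?z = "x \<otimes> inv (y [^] q)" and ?t = "u [^] n"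
  have z: "?z \<in> carrier G" using x y by simp
  have nq: "?t \<preceq> u [^] (q * n)" using q u by (intro pow_oleq_pow) auto
  have tq: "?t [^] q = u [^] (q * n)"
    using u by (simp add: nat_pow_pow mult.commute)
  \<comment> \<open>The remainder \<open>?z\<close> may be negative. Shifting it by
    \<open>?t [^] q\<close> makes it nonnegative, and the shift, being a \<open>q\<close>-th power,
    is absorbed into the witness at the end.\<close>
  have lo: "\<one> \<preceq> ?z \<otimes> ?t [^] q"
    using oleq_mult[of "inv ?t" ?z ?t "?t [^] q"] n(1) nq z u by (simp add: tq)
  have hi: "?z \<otimes> ?t [^] q \<preceq> u [^] (q * (2 * n))"
  proof -
    have "?z \<preceq> u [^] (q * n)"
      using n(2) nq z u oleq_trans[of ?z ?t "u [^] (q * n)"] by simp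
    then have "?z \<otimes> u [^] (q * n) \<preceq> u [^] (q * n) \<otimes> u [^] (q * n)"
      using z u by (intro oleq_mult) (auto simp: oleq_refl)
    then show ?thesis using u by (simp add: tq nat_pow_mult mult_2 distrib_left)
  qed
  obtain y' where y': "y' \<in> carrier G" "\<one> \<preceq> ?z \<otimes> ?t [^] q \<otimes> inv (y' [^] q)"
    "?z \<otimes> ?t [^] q \<otimes> inv (y' [^] q) \<preceq> u [^] q"
    using reduce[OF _ lo hi] z u by auto
  have "?z \<otimes> ?t [^] q \<otimes> inv (y' [^] q) = x \<otimes> inv ((y \<otimes> inv ?t \<otimes> y') [^] q)"
    using x y y' u by (simp add: nat_pow_distrib nat_pow_inv inv_mult m_assoc)
  then show "\<exists>y\<in>carrier G. \<one> \<preceq> x \<otimes> inv (y [^] q) \<and> x \<otimes> inv (y [^] q) \<preceq> u [^] q"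
    using y y' u by (intro bexI[of _ "y \<otimes> inv ?t \<otimes> y'"]) auto
qed

end

section \<open>Quotients and the regular rank\<close>

lemma oag_quot_simps [simp]:
  "carrier (oag_quot G C) = carrier (G Mod C)"
  "monoid.mult (oag_quot G C) = monoid.mult (G Mod C)"
  "one (oag_quot G C) = one (G Mod C)"
  "x [^]\<^bsub>oag_quot G C\<^esub> (n::nat) = x [^]\<^bsub>G Mod C\<^esub> n"
  "inv\<^bsub>oag_quot G C\<^esub> x = inv\<^bsub>G Mod C\<^esub> x"
  by (simp_all add: oag_quot_def nat_pow_def m_inv_def)

lemma comm_group_oag_quot:
  assumes "comm_group G" "subgroup C G"
  shows "comm_group (oag_quot G C)"
proof -
  have "comm_group (G Mod C)"
    using assms by (rule comm_group.abelian_FactGroup)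
  then show ?thesis
    unfolding comm_group_def comm_monoid_def comm_monoid_axioms_def group_def group_axioms_def
      monoid_def Units_def oag_quot_simps .
qed

lemma (in group) rcos_eq_iff:
  assumes "subgroup C G" "a \<in> carrier G" "b \<in> carrier G"
  shows "C #> a = C #> b \<longleftrightarrow> a \<otimes> inv b \<in> C"
proof
  interpret C: subgroup C G by fact
  assume "C #> a = C #> b"
  then have "C #> (a \<otimes> inv b) = C"
    using coset_mult_inv2[of C a b] assms C.subset by blast
  then show "a \<otimes> inv b \<in> C"
    using coset_join1[of C "a \<otimes> inv b"] assms by blast
next
  interpret C: subgroup C G by fact
  assume "a \<otimes> inv b \<in> C"
  then have "C #> (a \<otimes> inv b) = C"
    using coset_join2[of "a \<otimes> inv b" C] assms by blast
  then show "C #> a = C #> b"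
    using coset_mult_inv1[of C a b] assms C.subset by blast
qed

lemma n_divisible_oag_quot_iff:
  fixes G :: "'a ord_monoid" (structure)
  assumes "comm_group G" "subgroup C G"
  shows "n_divisible n (oag_quot G C) \<longleftrightarrow>
    (\<forall>x\<in>carrier G. \<exists>y\<in>carrier G. x \<otimes> inv (y [^] n) \<in> C)"
proof -
  interpret comm_group G by fact
  interpret C: normal C G using assms by (simp add: subgroup_imp_normal)
  have "(C #> y) [^]\<^bsub>G Mod C\<^esub> n = C #> x \<longleftrightarrow> x \<otimes> inv (y [^] n) \<in> C"
    if "x \<in> carrier G" "y \<in> carrier G" for x y
    using that rcos_eq_iff[OF assms(2), of x "y [^] n"] by (auto simp: C.FactGroup_pow)
  then show ?thesis
    unfolding n_divisible_def by (auto simp: carrier_FactGroup)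
qed

context oag
begin

text \<open>Convex subgroups of the quotient correspond to the convex subgroups \<open>D\<close> of
  \<open>G\<close> above \<open>C\<close>, the trivial one to \<open>C\<close> itself. The iterated
  quotient by the image of \<open>D\<close> is \<open>n\<close>-divisible exactly when
  \<open>G = D + nG\<close>.\<close>

lemma n_regular_oag_quot_iff:
  assumes C: "convex_subgroup C G"
  shows "n_regular n (oag_quot G C) \<longleftrightarrow>
    (\<forall>D. convex_subgroup D G \<and> C \<subset> D \<longrightarrow> carrier G \<subseteq> add_pow n D)"
proof -
  have Csub: "subgroup C G" using C by (rule convex_subgroup_subgroup)
  interpret C: normal C G using Csub by (simp add: subgroup_imp_normal)
  let ?Q = "oag_quot G C" and ?\<pi> = "\<lambda>a. C #> a"
  interpret Q: comm_group ?Q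
    using comm_group_axioms Csub by (rule comm_group_oag_quot)
  have carrQ: "carrier ?Q = ?\<pi> ` carrier G" by (simp add: carrier_FactGroup)
  have leQ: "?\<pi> a \<preceq>\<^bsub>?Q\<^esub> ?\<pi> b" if "a \<preceq> b" "a \<in> carrier G" "b \<in> carrier G" for a b
    using that rcos_self[OF _ Csub] by (auto simp: oag_quot_def)
  have leQD: "\<exists>c\<in>C. \<exists>d\<in>C. c \<otimes> a \<preceq> d \<otimes> b" if "?\<pi> a \<preceq>\<^bsub>?Q\<^esub> ?\<pi> b" for a b
    using that by (auto simp: oag_quot_def r_coset_def)
  have mulQ: "?\<pi> a \<otimes>\<^bsub>?Q\<^esub> ?\<pi> b = ?\<pi> (a \<otimes> b)" if "a \<in> carrier G" "b \<in> carrier G" for a b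
    using that by (simp add: C.rcos_sum)
  have invQ: "inv\<^bsub>?Q\<^esub> (?\<pi> a) = ?\<pi> (inv a)" if "a \<in> carrier G" for a
    using that C.rcos_inv[of a] C.inv_FactGroup[of "?\<pi> a"] by (simp add: carrier_FactGroup)
  have powQ: "(?\<pi> a) [^]\<^bsub>?Q\<^esub> n = ?\<pi> (a [^] n)" if "a \<in> carrier G" for a
    using that by (simp add: C.FactGroup_pow)
  have oneQ: "\<one>\<^bsub>?Q\<^esub> = C" by simp
  have piC: "?\<pi> a = C \<longleftrightarrow> a \<in> C" if "a \<in> carrier G" for a
    using that coset_join1 coset_join2 Csub by metis
  have div: "n_divisible n (oag_quot ?Q X) \<longleftrightarrow>
    (\<forall>h\<in>carrier G. \<exists>y\<in>carrier G. ?\<pi> (h \<otimes> inv (y [^] n)) \<in> X)"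
    if "subgroup X ?Q" for X
  proof -
    have "?\<pi> h \<otimes>\<^bsub>?Q\<^esub> inv\<^bsub>?Q\<^esub> (?\<pi> y [^]\<^bsub>?Q\<^esub> n) = ?\<pi> (h \<otimes> inv (y [^] n))"
      if "h \<in> carrier G" "y \<in> carrier G" for h y
      using that by (simp only: powQ invQ mulQ nat_pow_closed inv_closed)
    then show ?thesis
      unfolding n_divisible_oag_quot_iff[OF Q.comm_group_axioms that] carrQ by auto
  qed
  show ?thesis
  proof
    assume reg: "n_regular n ?Q"
    show "\<forall>D. convex_subgroup D G \<and> C \<subset> D \<longrightarrow> carrier G \<subseteq> add_pow n D"
    proof (intro allI impI subsetI)
      fix D h assume "convex_subgroup D G \<and> C \<subset> D" and h: "h \<in> carrier G"
      then have D: "convex_subgroup D G" and CD: "C \<subseteq> D" "C \<noteq> D" by auto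
      interpret D: subgroup D G using D by (rule convex_subgroup_subgroup)
      let ?X = "?\<pi> ` D"
      \<comment> \<open>Since \<open>C \<subseteq> D\<close>, the preimage of the image of
        \<open>D\<close> is \<open>D\<close> again.\<close>
      have in_D: "a \<in> D" if "a \<in> carrier G" "?\<pi> a \<in> ?X" for a
      proof -
        from that(2) obtain d where eq: "?\<pi> a = ?\<pi> d" and d: "d \<in> D" by (rule imageE)
        then have "a \<otimes> inv d \<in> D"
          using rcos_eq_iff[OF Csub that(1) D.mem_carrier[OF d]] eq CD(1) by blast
        then have "a \<otimes> inv d \<otimes> d \<in> D" using d by (rule D.m_closed)
        then show ?thesis using that d by (simp add: m_assoc)
      qed
      have subX: "subgroup ?X ?Q"
      proof (rule Q.subgroupI)
        show "?X \<subseteq> carrier ?Q" unfolding carrQ using D.subset by blast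
        show "?X \<noteq> {}" using D.one_closed by blast
        show "inv\<^bsub>?Q\<^esub> x \<in> ?X" if "x \<in> ?X" for x
        proof -
          from that obtain a where a: "x = ?\<pi> a" "a \<in> D" by (rule imageE)
          then have "inv\<^bsub>?Q\<^esub> x = ?\<pi> (inv a)" by (simp only: invQ D.mem_carrier)
          then show ?thesis using a(2) by (simp only: imageI D.m_inv_closed)
        qed
        show "x \<otimes>\<^bsub>?Q\<^esub> y \<in> ?X" if xy: "x \<in> ?X" "y \<in> ?X" for x y
        proof -
          from xy(1) obtain a where a: "x = ?\<pi> a" "a \<in> D" by (rule imageE)
          from xy(2) obtain b where b: "y = ?\<pi> b" "b \<in> D" by (rule imageE)
          have "x \<otimes>\<^bsub>?Q\<^esub> y = ?\<pi> (a \<otimes> b)" using a b by (simp only: mulQ D.mem_carrier)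
          then show ?thesis using a(2) b(2) by (simp only: imageI D.m_closed)
        qed
      qed
      have "convex_subgroup ?X ?Q"
        unfolding convex_subgroup_def
      proof (intro conjI ballI impI subX)
        fix x y z assume "x \<in> ?X" "y \<in> ?X" "z \<in> carrier ?Q" "x \<preceq>\<^bsub>?Q\<^esub> z \<and> z \<preceq>\<^bsub>?Q\<^esub> y"
        then obtain a b e where abe: "a \<in> D" "b \<in> D" "e \<in> carrier G"
          "x = ?\<pi> a" "y = ?\<pi> b" "z = ?\<pi> e" "?\<pi> a \<preceq>\<^bsub>?Q\<^esub> ?\<pi> e" "?\<pi> e \<preceq>\<^bsub>?Q\<^esub> ?\<pi> b"
          unfolding carrQ by (elim imageE) simp
        obtain c1 c2 where c: "c1 \<in> C" "c2 \<in> C" "c1 \<otimes> a \<preceq> c2 \<otimes> e"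
          using leQD[OF abe(7)] by blast
        obtain c3 c4 where c': "c3 \<in> C" "c4 \<in> C" "c3 \<otimes> e \<preceq> c4 \<otimes> b"
          using leQD[OF abe(8)] by blast
        have inD: "c1 \<in> D" "c2 \<in> D" "c3 \<in> D" "c4 \<in> D" using c c' CD by auto
        then have inG: "c1 \<in> carrier G" "c2 \<in> carrier G" "c3 \<in> carrier G" "c4 \<in> carrier G"
          "a \<in> carrier G" "b \<in> carrier G" using abe by auto
        \<comment> \<open>The order on cosets only compares some representatives. The correcting
          factors lie in \<open>C \<subseteq> D\<close>, so moving them to the outer sides bounds
          \<open>e\<close> by elements of \<open>D\<close>.\<close>
        have "inv c2 \<otimes> (c1 \<otimes> a) \<preceq> inv c2 \<otimes> (c2 \<otimes> e)"
          "inv c3 \<otimes> (c3 \<otimes> e) \<preceq> inv c3 \<otimes> (c4 \<otimes> b)"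
          using c c' abe inG by (intro oleq_mult_mono; simp)+
        then have "inv c2 \<otimes> (c1 \<otimes> a) \<preceq> e" "e \<preceq> inv c3 \<otimes> (c4 \<otimes> b)"
          using inG abe by (simp_all add: m_assoc[symmetric])
        then have "e \<in> D"
          using convex_subgroup_convex[OF D, of "inv c2 \<otimes> (c1 \<otimes> a)" "inv c3 \<otimes> (c4 \<otimes> b)" e]
            inD abe by auto
        then show "z \<in> ?X" using abe by blast
      qed
      moreover have "?X \<noteq> {\<one>\<^bsub>?Q\<^esub>}"
      proof
        assume eq: "?X = {\<one>\<^bsub>?Q\<^esub>}"
        have "?\<pi> d = C" if "d \<in> D" for d
          using imageI[OF that, of ?\<pi>] unfolding eq oneQ by (rule singletonD)
        then have "D \<subseteq> C"
          using piC[OF D.mem_carrier] by (intro subsetI) (simp only:)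
        then show False using CD by blast
      qed
      ultimately have "n_divisible n (oag_quot ?Q ?X)"
        using reg unfolding n_regular_def by blast
      then have "\<forall>h\<in>carrier G. \<exists>y\<in>carrier G. ?\<pi> (h \<otimes> inv (y [^] n)) \<in> ?X"
        unfolding div[OF subX] .
      from bspec[OF this h]
      obtain y where y: "?\<pi> (h \<otimes> inv (y [^] n)) \<in> ?X" "y \<in> carrier G" by (rule bexE)
      have "h \<otimes> inv (y [^] n) \<in> D"
        by (rule in_D[OF _ y(1)]) (simp add: h y(2))
      then show "h \<in> add_pow n D"
        unfolding add_pow_def using h y(2) by blast
    qed
  next
    assume *: "\<forall>D. convex_subgroup D G \<and> C \<subset> D \<longrightarrow> carrier G \<subseteq> add_pow n D"
    show "n_regular n ?Q"
      unfolding n_regular_def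
    proof (intro allI impI)
      fix X assume "convex_subgroup X ?Q \<and> X \<noteq> {\<one>\<^bsub>?Q\<^esub>}"
      then have X: "convex_subgroup X ?Q" and ne: "X \<noteq> {C}" by auto
      have subX: "subgroup X ?Q" using X by (rule convex_subgroup_subgroup)
      \<comment> \<open>The assumption is applied to the preimage of \<open>X\<close>, which is
        strictly larger than \<open>C\<close> because \<open>X\<close> is nontrivial.\<close>
      let ?D = "{a \<in> carrier G. ?\<pi> a \<in> X}"
      have CX: "C \<in> X" using subgroup.one_closed[OF subX] by simp
      have "subgroup ?D G"
      proof (rule subgroupI)
        have "\<one> \<in> ?D" using CX piC[of \<one>] by auto
        then show "?D \<noteq> {}" by blast
        show "inv a \<in> ?D" if "a \<in> ?D" for a
          using that invQ[of a] subgroup.m_inv_closed[OF subX, of "?\<pi> a"] by auto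
        show "a \<otimes> b \<in> ?D" if "a \<in> ?D" "b \<in> ?D" for a b
          using that mulQ[of a b] subgroup.m_closed[OF subX, of "?\<pi> a" "?\<pi> b"] by auto
      qed auto
      moreover have "z \<in> ?D" if "x \<in> ?D" "y \<in> ?D" "z \<in> carrier G" "x \<preceq> z \<and> z \<preceq> y" for x y z
        using that convex_subgroup_convex[OF X, of "?\<pi> x" "?\<pi> y" "?\<pi> z"] leQ
        by (auto simp: carrier_FactGroup)
      ultimately have "convex_subgroup ?D G"
        unfolding convex_subgroup_def by blast
      moreover have "C \<subset> ?D"
      proof
        show "C \<subseteq> ?D"
        proof
          fix c assume c: "c \<in> C"
          then have "?\<pi> c = C" using piC[OF C.mem_carrier] by blast
          then show "c \<in> ?D" using c CX by simp
        qed
        show "C \<noteq> ?D"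
        proof
          assume eq: "C = ?D"
          have "X = {C}"
          proof (intro equalityI subsetI)
            fix x assume x: "x \<in> X"
            then obtain a where a: "a \<in> carrier G" "x = ?\<pi> a"
              using subgroup.mem_carrier[OF subX] unfolding carrQ by blast
            then have "a \<in> C" using x eq by blast
            then show "x \<in> {C}" using a piC by auto
          qed (use CX in auto)
          then show False using ne by blast
        qed
      qed
      ultimately have "carrier G \<subseteq> add_pow n ?D" using * by blast
      then show "n_divisible n (oag_quot ?Q X)"
        unfolding div[OF subX] add_pow_def by blast
    qed
  qed
qed

text \<open>The characterization for quotients is applied to \<open>B\<close> as an ordered group of
  its own. Its convex subgroups are those of \<open>G\<close> contained in \<open>B\<close>, and by
  purity of \<open>B\<close> it makes no difference whether an element is divided by
  \<open>n\<close> in \<open>B\<close> or in \<open>G\<close>.\<close>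

lemma n_regular_segment_iff:
  assumes B: "convex_subgroup B G" and C: "convex_subgroup C G" "C \<subseteq> B" and n: "n > 0"
  shows "n_regular n (oag_quot (G\<lparr>carrier := B\<rparr>) C) \<longleftrightarrow>
    (\<forall>D. convex_subgroup D G \<and> C \<subset> D \<and> D \<subseteq> B \<longrightarrow> B \<subseteq> add_pow n D)"
proof -
  have sB: "subgroup B G" using B by (rule convex_subgroup_subgroup)
  interpret B: subgroup B G by (rule sB)
  let ?H = "G\<lparr>carrier := B\<rparr>"
  interpret H: comm_group ?H
    using m_comm by (intro group.group_comm_groupI subgroup_imp_group sB) simp
  interpret H: oag ?H
  proof
    show "x \<preceq>\<^bsub>?H\<^esub> z" if "x \<in> carrier ?H" "y \<in> carrier ?H" "z \<in> carrier ?H"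
      "x \<preceq>\<^bsub>?H\<^esub> y" "y \<preceq>\<^bsub>?H\<^esub> z" for x y z
      using that oleq_trans[of x y z] by simp
  qed (simp_all add: oleq_refl oleq_antisym oleq_total oleq_mult_mono)
  have sub: "subgroup D ?H \<longleftrightarrow> subgroup D G \<and> D \<subseteq> B" for D
    using subgroup_incl[OF _ sB] incl_subgroup[OF sB] subgroup.subset by fastforce
  have conv: "convex_subgroup D ?H \<longleftrightarrow> convex_subgroup D G \<and> D \<subseteq> B" for D
  proof
    assume D: "convex_subgroup D ?H"
    then have DB: "subgroup D G" "D \<subseteq> B" using sub by (auto simp: convex_subgroup_def)
    have "z \<in> D" if "x \<in> D" "y \<in> D" "z \<in> carrier G" "x \<preceq> z" "z \<preceq> y" for x y z
    proof -
      have "z \<in> B"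
        by (rule convex_subgroup_convex[OF B _ _ that(3-5)]) (use that DB in auto)
      then show ?thesis
        using convex_subgroup_convex[OF D that(1,2), of z] that(4,5) by simp
    qed
    then show "convex_subgroup D G \<and> D \<subseteq> B"
      using DB unfolding convex_subgroup_def by (intro conjI ballI impI) (assumption | elim conjE)+
  next
    assume D: "convex_subgroup D G \<and> D \<subseteq> B"
    then have "subgroup D ?H" using sub convex_subgroup_subgroup by blast
    moreover have "z \<in> D"
      if "x \<in> D" "y \<in> D" "z \<in> carrier ?H" "x \<preceq>\<^bsub>?H\<^esub> z \<and> z \<preceq>\<^bsub>?H\<^esub> y" for x y z
    proof -
      have "z \<in> carrier G" "x \<preceq> z" "z \<preceq> y" using that(3,4) by auto
      then show ?thesis using convex_subgroup_convex[OF conjunct1[OF D] that(1,2)] by blast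
    qed
    ultimately show "convex_subgroup D ?H" unfolding convex_subgroup_def by blast
  qed
  have ap: "H.add_pow n D = B \<inter> add_pow n D" if D: "convex_subgroup D G" "D \<subseteq> B" for D
  proof -
    \<comment> \<open>The power \<open>y [^] n\<close> is a quotient of two elements of
      \<open>B\<close>, so purity puts \<open>y\<close> itself into \<open>B\<close>.\<close>
    have "y \<in> B" if "x \<in> B" "y \<in> carrier G" "x \<otimes> inv (y [^] n) \<in> D" for x y
    proof -
      have "inv (x \<otimes> inv (y [^] n)) \<otimes> x \<in> B" using that D by auto
      moreover have "inv (x \<otimes> inv (y [^] n)) \<otimes> x = y [^] n"
        using that by (simp add: inv_mult m_comm[of "inv x"] m_assoc)
      ultimately show ?thesis using convex_subgroup_pure[OF B that(2)] n by simp
    qed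
    then have "{x \<in> B. \<exists>y\<in>B. x \<otimes> inv (y [^] n) \<in> D} = B \<inter> add_pow n D"
      unfolding add_pow_def using B.subset by blast
    moreover have "inv\<^bsub>?H\<^esub> (y [^]\<^bsub>?H\<^esub> n) = inv (y [^] n)" if "y \<in> B" for y
      using that H.nat_pow_closed[of y n] m_inv_consistent[OF sB]
      by (simp add: nat_pow_consistent[symmetric])
    then have "H.add_pow n D = {x \<in> B. \<exists>y\<in>B. x \<otimes> inv (y [^] n) \<in> D}"
      unfolding H.add_pow_def by simp
    ultimately show ?thesis by (rule trans[rotated])
  qed
  have "n_regular n (oag_quot ?H C) \<longleftrightarrow>
    (\<forall>D. (convex_subgroup D G \<and> D \<subseteq> B) \<and> C \<subset> D \<longrightarrow> B \<subseteq> H.add_pow n D)"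
    using H.n_regular_oag_quot_iff[of C n] C conv by simp
  then show ?thesis using ap by auto
qed

text \<open>Call a convex \<open>D \<subseteq> B\<close> bad if \<open>B\<close> is not contained in
  \<open>D + nG\<close>. As convex subgroups form a chain, the quotient by \<open>C\<close> is
  \<open>n\<close>-regular iff \<open>C\<close> contains every bad \<open>D\<close>, so
  \<open>A_conv G n g\<close> is the union of the bad ones. The last two claims restate this for
  subgroups generated by one element.\<close>

lemma A_conv_least:
  fixes n :: nat
  assumes g: "g \<in> carrier G" and n: "n > 0"
  defines "B \<equiv> B_conv G g"
  shows "convex_subgroup (A_conv G n g) G"
    and "\<And>d. \<lbrakk>d \<in> carrier G; \<one> \<preceq> d; d \<notin> A_conv G n g\<rbrakk> \<Longrightarrow> B \<subseteq> add_pow n (cspan d)"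
    and "\<And>C. \<lbrakk>convex_subgroup C G; C \<subset> A_conv G n g\<rbrakk> \<Longrightarrow>
           \<exists>d. d \<in> A_conv G n g \<and> d \<notin> C \<and> \<one> \<preceq> d \<and> \<not> B \<subseteq> add_pow n (cspan d)"
proof -
  have B: "convex_subgroup B G" unfolding B_def using convex_B_conv[OF g] .
  let ?bad = "{D. convex_subgroup D G \<and> D \<subseteq> B \<and> \<not> B \<subseteq> add_pow n D}"
  \<comment> \<open>Inserting \<open>{\<one>}\<close> keeps the union a subgroup when nothing is
    bad.\<close>
  let ?A = "\<Union>(insert {\<one>} ?bad)"
  have one_le: "{\<one>} \<subseteq> C" if "convex_subgroup C G" for C
    using that by (simp add: convex_subgroup_def subgroup.one_closed)
  have A: "convex_subgroup ?A G"
    using convex_one by (intro convex_subgroup_Union) auto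
  have AB: "?A \<subseteq> B" using one_le[OF B] by auto
  have regA: "n_regular n (oag_quot (G\<lparr>carrier := B\<rparr>) ?A)"
    unfolding n_regular_segment_iff[OF B A AB n] by blast
  have minA: "?A \<subseteq> C" if C: "convex_subgroup C G" "C \<subseteq> B"
    and reg: "n_regular n (oag_quot (G\<lparr>carrier := B\<rparr>) C)" for C
  proof -
    have "D \<subseteq> C" if "D \<in> ?bad" for D
      using reg that convex_subgroup_linear[OF C(1), of D]
      unfolding n_regular_segment_iff[OF B C n] by blast
    then show ?thesis using one_le[OF C(1)] by blast
  qed
  have eq: "A_conv G n g = ?A"
    unfolding A_conv_def B_def[symmetric]
    by (rule Least_equality) (use A AB regA minA in auto)
  show "convex_subgroup (A_conv G n g) G" using A eq by simp
  show "B \<subseteq> add_pow n (cspan d)" if d: "d \<in> carrier G" "\<one> \<preceq> d" "d \<notin> A_conv G n g" for d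
  \<comment> \<open>A convex subgroup inside \<open>B\<close> that contains an element outside the
    union cannot be bad. The other possibility is that \<open>cspan d\<close> contains
    \<open>B\<close>.\<close>
  proof (cases "cspan d \<subseteq> B")
    case True
    then show ?thesis
      using d convex_cspan[OF d(1,2)] cspan_self[OF d(1,2)] unfolding eq by blast
  next
    case False
    then have "B \<subseteq> cspan d" using convex_subgroup_linear[OF B convex_cspan[OF d(1,2)]] by blast
    moreover have "cspan d \<subseteq> add_pow n (cspan d)"
      unfolding add_pow_def using subgroup.mem_carrier[OF convex_subgroup_subgroup[OF convex_cspan[OF d(1,2)]]]
      by (auto intro!: bexI[of _ \<one>])
    ultimately show ?thesis by blast
  qed
  show "\<exists>d. d \<in> A_conv G n g \<and> d \<notin> C \<and> \<one> \<preceq> d \<and> \<not> B \<subseteq> add_pow n (cspan d)"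
    if C: "convex_subgroup C G" "C \<subset> A_conv G n g" for C
  proof -
    \<comment> \<open>Some bad \<open>D\<close> is not contained in \<open>C\<close>. The subgroup
      generated by an element of \<open>D\<close> outside \<open>C\<close> is smaller than
      \<open>D\<close> and hence bad as well.\<close>
    obtain D d where D: "D \<in> ?bad" and d: "d \<in> D" "d \<notin> C"
      using C one_le[OF C(1)] unfolding eq by blast
    then have "subgroup D G" by (simp add: convex_subgroup_def)
    then have "d \<in> carrier G" "inv d \<in> D"
      using d by (auto dest: subgroup.mem_carrier subgroup.m_inv_closed)
    then obtain d' where d': "d' \<in> carrier G" "\<one> \<preceq> d'" "d' \<notin> C" "d' \<in> D"
      using nonneg_outside[OF C(1) _ d(2)] d by metis
    then have "add_pow n (cspan d') \<subseteq> add_pow n D"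
      using D by (intro add_pow_mono cspan_least) auto
    then show ?thesis using d' D unfolding eq by blast
  qed
qed

end

section \<open>Chains of elements\<close>

context oag
begin

text \<open>The smaller element comes first, so powers of this relation describe increasing chains.
  Nonnegativity makes \<open>cspan u\<close> the convex subgroup generated by
  \<open>u\<close>.\<close>

definition dom_rel :: "nat \<Rightarrow> ('a \<times> 'a) set" where
  "dom_rel p = {(u, h). u \<in> carrier G \<and> h \<in> carrier G \<and> \<one> \<preceq> u \<and> \<one> \<preceq> h \<and>
                        h \<notin> add_pow p (cspan u)}"

lemma subset_add_pow: "C \<subseteq> carrier G \<Longrightarrow> C \<subseteq> add_pow q C"
  unfolding add_pow_def by (auto intro!: bexI[of _ \<one>])

lemma cspan_subset_carrier: "cspan u \<subseteq> carrier G"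
  unfolding cspan_def by blast

lemma cspan_mono:
  assumes "u \<in> carrier G" "\<one> \<preceq> u" "v \<in> cspan u"
  shows "cspan v \<subseteq> cspan u"
  using assms cspan_least convex_cspan by blast

text \<open>Otherwise \<open>h \<preceq> u\<close>, and convexity would put \<open>h\<close> into
  \<open>cspan u\<close>, which is contained in \<open>add_pow p (cspan u)\<close>.\<close>

lemma dom_rel_cspan:
  assumes "(u, h) \<in> dom_rel p"
  shows "u \<in> cspan h"
proof -
  have u: "u \<in> carrier G" "\<one> \<preceq> u" and h: "h \<in> carrier G" "\<one> \<preceq> h"
    and "h \<notin> add_pow p (cspan u)"
    using assms by (auto simp: dom_rel_def)
  then have "h \<notin> cspan u" using subset_add_pow[OF cspan_subset_carrier] by blast
  moreover have one: "\<one> \<in> cspan u" "\<one> \<in> cspan h"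
    using convex_cspan[OF u] convex_cspan[OF h]
    by (simp_all add: convex_subgroup_def subgroup.one_closed)
  ultimately have "\<not> h \<preceq> u"
    using convex_subgroup_convex[OF convex_cspan[OF u] one(1) cspan_self[OF u] h] by blast
  then have "u \<preceq> h" using oleq_total[OF u(1) h(1)] by blast
  then show ?thesis
    using convex_subgroup_convex[OF convex_cspan[OF h] one(2) cspan_self[OF h] u] by blast
qed

lemma dom_rel_cspan_left:
  assumes "(u, h) \<in> dom_rel p" "v \<in> cspan u" "\<one> \<preceq> v"
  shows "(v, h) \<in> dom_rel p"
proof -
  have "add_pow p (cspan v) \<subseteq> add_pow p (cspan u)"
    using assms by (intro add_pow_mono cspan_mono) (auto simp: dom_rel_def)
  then show ?thesis
    using assms cspan_subset_carrier by (auto simp: dom_rel_def)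
qed

text \<open>The left member may be replaced by any nonnegative element of the convex subgroup it
  generates, and for \<open>v\<close> the element \<open>u\<close> is such a replacement.\<close>

lemma trans_dom_rel: "trans (dom_rel p)"
proof (rule transI)
  fix u v w assume "(u, v) \<in> dom_rel p" "(v, w) \<in> dom_rel p"
  then show "(u, w) \<in> dom_rel p"
    using dom_rel_cspan_left[of v w p u] dom_rel_cspan[of u v p] by (auto simp: dom_rel_def)
qed

lemma add_pow_mult_pow:
  assumes "x \<in> carrier G" "y \<in> carrier G" "x \<otimes> y [^] (q::nat) \<in> add_pow q C"
  shows "x \<in> add_pow q C"
proof -
  obtain z where z: "z \<in> carrier G" "x \<otimes> y [^] q \<otimes> inv (z [^] q) \<in> C"
    using assms unfolding add_pow_def by blast
  moreover have "x \<otimes> y [^] q \<otimes> inv (z [^] q) = x \<otimes> inv ((inv y \<otimes> z) [^] q)"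
    using assms z by (simp add: nat_pow_distrib nat_pow_inv inv_mult m_assoc)
  ultimately show ?thesis
    unfolding add_pow_def using assms by (auto intro!: bexI[of _ "inv y \<otimes> z"])
qed

lemma add_pow_inv:
  assumes C: "subgroup C G" and x: "x \<in> carrier G" "inv x \<in> add_pow q C"
  shows "x \<in> add_pow q C"
proof -
  obtain z where z: "z \<in> carrier G" "inv x \<otimes> inv (z [^] q) \<in> C"
    using x unfolding add_pow_def by blast
  have "inv (inv x \<otimes> inv (z [^] q)) = x \<otimes> inv (inv z [^] q)"
    using x z by (simp add: nat_pow_inv inv_mult)
  then have "x \<otimes> inv (inv z [^] q) \<in> C"
    using subgroup.m_inv_closed[OF C z(2)] by simp
  then show ?thesis
    unfolding add_pow_def using x z by (auto intro!: bexI[of _ "inv z"])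
qed

text \<open>Each further member of \<open>RJ p G\<close> lengthens the chain by one step. The
  induction needs control over the end of the chain: it must fit into \<open>cspan d\<close> for
  every nonnegative \<open>d\<close> outside the greatest member of \<open>S\<close>, so that the
  next element can be placed above it.\<close>

lemma RJ_chain_aux:
  assumes p: "p > 0"
  shows "\<lbrakk>finite S; S \<subseteq> RJ p G; card S = Suc n\<rbrakk> \<Longrightarrow>
    \<exists>A\<in>S. (\<forall>A'\<in>S. A' \<subseteq> A) \<and>
      (\<forall>d\<in>carrier G. \<one> \<preceq> d \<and> d \<notin> A \<longrightarrow>
         (\<exists>a b. (a, b) \<in> dom_rel p ^^ n \<and> \<one> \<preceq> b \<and> b \<in> cspan d))"
proof (induction n arbitrary: S)
  case 0
  then obtain A where "S = {A}" by (metis One_nat_def card_1_singletonE)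
  then show ?case using cspan_self by auto
next
  case (Suc n)
  have RJ_convex: "convex_subgroup A G" if "A \<in> RJ p G" for A
    using that A_conv_least(1) p by (auto simp: RJ_def)
  have "S \<noteq> {}" using Suc.prems by auto
  then obtain A where A: "A \<in> S" and "\<forall>A'\<in>S. A \<subseteq> A' \<longrightarrow> A = A'"
    using finite_has_maximal[OF Suc.prems(1)] by blast
  then have max: "A' \<subseteq> A" if "A' \<in> S" for A'
    using that convex_subgroup_linear[of A A'] RJ_convex[of A] RJ_convex[of A'] A Suc.prems(2)
    by blast
  have "finite (S - {A})" "S - {A} \<subseteq> RJ p G" "card (S - {A}) = Suc n"
    using Suc.prems A by auto
  from Suc.IH[OF this] obtain A' where A': "A' \<in> S - {A}"
    and IH: "\<forall>d\<in>carrier G. \<one> \<preceq> d \<and> d \<notin> A' \<longrightarrow>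
        (\<exists>a b. (a, b) \<in> dom_rel p ^^ n \<and> \<one> \<preceq> b \<and> b \<in> cspan d)"
    by (elim bexE conjE)
  have A'A: "A' \<subset> A" using A' max by blast
  obtain g where g: "g \<in> carrier G" "A = A_conv G p g"
    using A Suc.prems by (auto simp: RJ_def)
  have convA': "convex_subgroup A' G" using A' RJ_convex Suc.prems by blast
  \<comment> \<open>With \<open>A'\<close> the greatest of the remaining members, minimality of
    \<open>A\<close> supplies an element \<open>c\<close> between \<open>A'\<close> and
    \<open>A\<close> and an \<open>h\<close> in \<open>B(g)\<close> outside
    \<open>B(c) + pG\<close>. The chain from the induction hypothesis then ends inside
    \<open>cspan c\<close>.\<close>
  obtain c where c: "c \<in> A" "c \<notin> A'" "\<one> \<preceq> c"
    and "\<not> B_conv G g \<subseteq> add_pow p (cspan c)"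
    using A_conv_least(3)[OF g(1) p convA'] A'A unfolding g(2) by blast
  then obtain h where h: "h \<in> B_conv G g" "h \<notin> add_pow p (cspan c)" by blast
  have hG: "h \<in> carrier G"
    using h convex_B_conv[OF g(1)] by (auto simp: convex_subgroup_def dest: subgroup.mem_carrier)
  have cG: "c \<in> carrier G"
    using c A RJ_convex Suc.prems by (meson convex_subgroup_subgroup subgroup.mem_carrier subsetD)
  obtain a b where ab: "(a, b) \<in> dom_rel p ^^ n" "\<one> \<preceq> b" "b \<in> cspan c"
    using bspec[OF IH cG] c by blast
  have "\<exists>a b. (a, b) \<in> dom_rel p ^^ Suc n \<and> \<one> \<preceq> b \<and> b \<in> cspan d"
    if d: "d \<in> carrier G" "\<one> \<preceq> d" "d \<notin> A" for d
  proof -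
    have sd: "subgroup (cspan d) G" and sc: "subgroup (cspan c) G"
      using convex_cspan d cG c by (auto simp: convex_subgroup_def)
    \<comment> \<open>As \<open>d\<close> lies outside \<open>A\<close>, the element
      \<open>h\<close> can be moved into \<open>cspan d\<close> by a \<open>p\<close>-th power. This
      leaves its class modulo \<open>p\<close>-th powers unchanged, so the result \<open>e\<close>
      still avoids \<open>add_pow p (cspan c)\<close>.\<close>
    have "h \<in> add_pow p (cspan d)"
      using A_conv_least(2)[OF g(1) p d(1,2)] d(3) h unfolding g(2) by blast
    then obtain y where y: "y \<in> carrier G" "h \<otimes> inv (y [^] p) \<in> cspan d"
      unfolding add_pow_def by blast
    define e where "e = h \<otimes> inv (y [^] p)"
    have e: "e \<in> carrier G" "e \<in> cspan d" using y hG by (auto simp: e_def)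
    have "e = h \<otimes> (inv y) [^] p" using y hG by (simp add: e_def nat_pow_inv)
    then have ne: "e \<notin> add_pow p (cspan c)"
      using add_pow_mult_pow[OF hG, of "inv y" p "cspan c"] y h by auto
    then have ne': "inv e \<notin> add_pow p (cspan c)"
      using add_pow_inv[OF sc e(1)] by blast
    have "\<exists>e'. e' \<in> cspan d \<and> \<one> \<preceq> e' \<and> e' \<notin> add_pow p (cspan c)"
    proof (cases "\<one> \<preceq> e")
      case False
      then have "\<one> \<preceq> inv e" using oleq_total[of \<one> e] one_oleq_inv e by auto
      then show ?thesis using ne' subgroup.m_inv_closed[OF sd e(2)] by blast
    qed (use e ne in blast)
    then obtain e' where e': "e' \<in> cspan d" "\<one> \<preceq> e'" "e' \<notin> add_pow p (cspan c)" by blast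
    then have "(c, e') \<in> dom_rel p"
      using cG c cspan_subset_carrier by (auto simp: dom_rel_def)
    then have "(b, e') \<in> dom_rel p" using dom_rel_cspan_left ab by blast
    with ab(1) have "(a, e') \<in> dom_rel p ^^ Suc n" by (rule relpow_Suc_I)
    then show ?thesis using e' by blast
  qed
  then show ?case using A max by blast
qed

lemma RJ_infinite_imp_chain:
  assumes p: "p > 0" and inf: "infinite (RJ p G)"
  shows "\<exists>a b. (a, b) \<in> dom_rel p ^^ n"
proof -
  \<comment> \<open>One of the \<open>n + 2\<close> members is spent on the greatest one,
    \<open>A\<close>: it supplies an element \<open>d\<close> outside the greatest \<open>A'\<close>
    of the other \<open>n + 1\<close>, as the auxiliary lemma requires.\<close>
  obtain S where S: "finite S" "S \<subseteq> RJ p G" "card S = Suc (Suc n)"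
    using infinite_arbitrarily_large[OF inf] by blast
  obtain A where A: "A \<in> S" "\<forall>A'\<in>S. A' \<subseteq> A"
    using RJ_chain_aux[OF p S] by blast
  have "finite (S - {A})" "S - {A} \<subseteq> RJ p G" "card (S - {A}) = Suc n"
    using S A by auto
  from RJ_chain_aux[OF p this] obtain A' where A': "A' \<in> S - {A}"
    and "\<forall>d\<in>carrier G. \<one> \<preceq> d \<and> d \<notin> A' \<longrightarrow>
         (\<exists>a b. (a, b) \<in> dom_rel p ^^ n \<and> \<one> \<preceq> b \<and> b \<in> cspan d)"
    by (elim bexE conjE)
  then have chain: "\<exists>a b. (a, b) \<in> dom_rel p ^^ n"
    if "d \<in> carrier G" "\<one> \<preceq> d" "d \<notin> A'" for d
    using that by blast
  obtain g where g: "g \<in> carrier G" "A = A_conv G p g"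
    using A S by (auto simp: RJ_def)
  have "convex_subgroup A' G" "A' \<subset> A_conv G p g"
    using A' A S A_conv_least(1) p g by (auto simp: RJ_def)
  then obtain d where "d \<in> A" "d \<notin> A'" "\<one> \<preceq> d"
    using A_conv_least(3)[OF g(1) p] g(2) by metis
  then show ?thesis
    using chain A_conv_least(1)[OF g(1) p] g(2) by (metis convex_subgroup_subgroup subgroup.mem_carrier)
qed

text \<open>The witness is \<open>w\<^sub>0 + p w\<^sub>1 + p\<^sup>2 w\<^sub>2 + \<dots>\<close>: modulo \<open>p\<^sup>i\<^sup>+\<^sup>1\<close> the terms after the \<open>i\<close>-th vanish,
  while those before it are absorbed by the convex subgroup generated by \<open>u\<^sub>i\<close>.\<close>

lemma independent_rows:
  assumes p: "p > 0"
    and uw: "\<And>i. (u i, w i) \<in> dom_rel p"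
    and wu: "\<And>i k. i < k \<Longrightarrow> w i \<in> cspan (u k)"
  shows "\<exists>x\<in>carrier G. \<forall>i<N. x \<in> add_pow (p ^ Suc i) (cspan (w i)) \<and>
                              x \<notin> add_pow (p ^ Suc i) (cspan (u i))"
proof -
  have uG: "u i \<in> carrier G" "\<one> \<preceq> u i" and wG: "w i \<in> carrier G" "\<one> \<preceq> w i"
    and not: "w i \<notin> add_pow p (cspan (u i))" for i
    using uw[of i] by (auto simp: dom_rel_def)
  \<comment> \<open>In additive notation, \<open>X i\<close> is the sum of the terms
    \<open>p^k w_k\<close> with \<open>k < i\<close>.\<close>
  define X where "X = rec_nat \<one> (\<lambda>i x. x \<otimes> w i [^] (p ^ i))"
  have X0: "X 0 = \<one>" and XS: "X (Suc i) = X i \<otimes> w i [^] (p ^ i)" for i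
    by (simp_all add: X_def)
  have XG: "X i \<in> carrier G" for i
    by (induction i) (auto simp: X0 XS wG)
  have sub: "subgroup (cspan (u i)) G" "subgroup (cspan (w i)) G" for i
    using convex_cspan uG wG by (auto simp: convex_subgroup_def)
  have pow_in: "a [^] (n::nat) \<in> C" if "subgroup C G" "a \<in> C" for a n C
    using that by (induction n) (auto simp: subgroup.one_closed subgroup.m_closed)
  have Xu: "i \<le> k \<Longrightarrow> X i \<in> cspan (u k)" for i k
  proof (induction i)
    case 0
    then show ?case using sub by (simp add: X0 subgroup.one_closed)
  next
    case (Suc i)
    then show ?case
      using sub wu[of i k] pow_in[of "cspan (u k)" "w i"]
      by (auto simp: XS intro!: subgroup.m_closed)
  qed
  have split: "\<exists>s\<in>carrier G. X (Suc i + k) = X i \<otimes> w i [^] (p ^ i) \<otimes> s [^] (p ^ Suc i)" for i k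
  proof (induction k)
    case 0
    then show ?case using XG wG by (intro bexI[of _ \<one>]) (auto simp: XS)
  next
    case (Suc k)
    then obtain s where s: "s \<in> carrier G"
      "X (Suc i + k) = X i \<otimes> w i [^] (p ^ i) \<otimes> s [^] (p ^ Suc i)" by blast
    let ?v = "w (Suc i + k)"
    have "?v [^] (p ^ (Suc i + k)) = (?v [^] (p ^ k)) [^] (p ^ Suc i)"
      using wG by (simp add: nat_pow_pow power_add mult_ac)
    then have "X (Suc i + Suc k) =
        X i \<otimes> w i [^] (p ^ i) \<otimes> (s [^] (p ^ Suc i) \<otimes> (?v [^] (p ^ k)) [^] (p ^ Suc i))"
      using s wG XG by (simp add: XS m_assoc del: power_Suc)
    also have "\<dots> = X i \<otimes> w i [^] (p ^ i) \<otimes> (s \<otimes> ?v [^] (p ^ k)) [^] (p ^ Suc i)"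
      using s wG by (simp add: nat_pow_distrib)
    finally show ?case using s wG by blast
  qed
  have "X N \<in> add_pow (p ^ Suc i) (cspan (w i)) \<and> X N \<notin> add_pow (p ^ Suc i) (cspan (u i))"
    if "i < N" for i
  proof -
    obtain k where "N = Suc i + k" using \<open>i < N\<close> less_iff_Suc_add by auto
    then obtain s where s: "s \<in> carrier G"
      and XN: "X N = X i \<otimes> w i [^] (p ^ i) \<otimes> s [^] (p ^ Suc i)"
      using split by blast
    have "X i \<in> cspan (w i)"
      using Xu[of i i] cspan_mono[OF wG] dom_rel_cspan[OF uw] by blast
    then have "X i \<otimes> w i [^] (p ^ i) \<in> cspan (w i)"
      using pow_in[OF sub(2) cspan_self[OF wG]] sub by (auto intro: subgroup.m_closed)
    moreover have "X N \<otimes> inv (s [^] (p ^ Suc i)) = X i \<otimes> w i [^] (p ^ i)"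
      using XN s wG XG by (simp add: m_assoc del: power_Suc)
    ultimately have 1: "X N \<in> add_pow (p ^ Suc i) (cspan (w i))"
      unfolding add_pow_def using s XG by (auto intro!: bexI[of _ s])
    have 2: "X N \<notin> add_pow (p ^ Suc i) (cspan (u i))"
    proof
      assume *: "X N \<in> add_pow (p ^ Suc i) (cspan (u i))"
      have "X i \<otimes> w i [^] (p ^ i) \<in> carrier G" using XG wG by simp
      from add_pow_mult_pow[OF this s *[unfolded XN]]
      obtain y where y: "y \<in> carrier G"
        "X i \<otimes> w i [^] (p ^ i) \<otimes> inv (y [^] (p ^ Suc i)) \<in> cspan (u i)"
        unfolding add_pow_def by blast
      \<comment> \<open>Removing \<open>X i\<close>, which lies in \<open>cspan (u i)\<close>,
        leaves the \<open>p ^ i\<close>-th power of \<open>w i \<otimes> inv (y [^] p)\<close>.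
        Purity cancels the exponent and contradicts the choice of \<open>w i\<close>.\<close>
      have "inv (X i) \<otimes> (X i \<otimes> w i [^] (p ^ i) \<otimes> inv (y [^] (p ^ Suc i))) \<in> cspan (u i)"
        using sub(1) y(2) Xu[of i i] by (auto intro!: subgroup.m_closed subgroup.m_inv_closed)
      also have "inv (X i) \<otimes> (X i \<otimes> w i [^] (p ^ i) \<otimes> inv (y [^] (p ^ Suc i))) =
          w i [^] (p ^ i) \<otimes> inv (y [^] (p ^ Suc i))"
        using XG wG y by (simp add: m_assoc[symmetric] del: power_Suc)
      also have "\<dots> = (w i \<otimes> inv (y [^] p)) [^] (p ^ i)"
        using wG y by (simp add: nat_pow_distrib nat_pow_inv nat_pow_pow mult.commute)
      finally have "w i \<otimes> inv (y [^] p) \<in> cspan (u i)"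
        using convex_subgroup_pure[OF convex_cspan[OF uG]] wG y p by simp
      then show False using not[of i] wG y unfolding add_pow_def by blast
    qed
    show ?thesis using 1 2 ..
  qed
  then show ?thesis using XG by blast
qed

end

section \<open>Definability\<close>

primrec tpow :: "nat \<Rightarrow> tm \<Rightarrow> tm" where
  "tpow 0 t = Zero"
| "tpow (Suc n) t = Plus (tpow n t) t"

text \<open>The bounded form of membership in \<open>B(u) + qG\<close>, where \<open>x\<close> and
  \<open>u\<close> are indices of variables. The bound index \<open>Suc (x + u)\<close> exceeds
  both, which prevents capture.\<close>

definition add_pow_fm :: "nat \<Rightarrow> nat \<Rightarrow> nat \<Rightarrow> fm" where
  "add_pow_fm q x u =
     (let y = Suc (x + u); t = Plus (Var x) (Minus (tpow q (Var y)))
      in Exi y (Conj (Le Zero t) (Le t (tpow q (Var u)))))"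

definition dom_fm :: "nat \<Rightarrow> nat \<Rightarrow> nat \<Rightarrow> fm" where
  "dom_fm p u h = Conj (Le Zero (Var u)) (Conj (Le Zero (Var h)) (Neg (add_pow_fm p h u)))"

text \<open>Chains of \<open>2 ^ n\<close> steps, built by doubling around a midpoint. A chain at
  level \<open>n + 1\<close> thus provides a midpoint with chains at level \<open>n\<close> on both
  sides, which is what interpolation uses.\<close>

primrec chain_fm :: "nat \<Rightarrow> nat \<Rightarrow> nat \<Rightarrow> nat \<Rightarrow> fm" where
  "chain_fm p 0 x y = dom_fm p x y"
| "chain_fm p (Suc n) x y =
     Exi (Suc (x + y)) (Conj (chain_fm p n x (Suc (x + y))) (chain_fm p n (Suc (x + y)) y))"

lemma tm_vars_tpow: "tm_vars (tpow n t) \<subseteq> tm_vars t"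
  by (induction n) auto

lemma fv_add_pow_fm: "fv (add_pow_fm q x u) \<subseteq> {x, u}"
  using tm_vars_tpow[of q "Var (Suc (x + u))"] tm_vars_tpow[of q "Var u"]
  by (auto simp: add_pow_fm_def Let_def)

lemma fv_chain_fm: "fv (chain_fm p n x y) \<subseteq> {x, y}"
proof (induction n arbitrary: x y)
  case 0
  then show ?case using fv_add_pow_fm[of p y x] by (auto simp: dom_fm_def)
next
  case (Suc n)
  show ?case using Suc.IH[of x "Suc (x + y)"] Suc.IH[of "Suc (x + y)" y] by auto
qed

lemma tm_val_tpow: "tm_val M v (tpow n t) = tm_val M v t [^]\<^bsub>M\<^esub> n"
  by (induction n) (simp_all add: nat_pow_def)

lemma (in oag) sat_add_pow_fm:
  assumes "v x \<in> carrier G" "v u \<in> carrier G" "\<one> \<preceq> v u" "q > 0"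
  shows "sat G v (add_pow_fm q x u) \<longleftrightarrow> v x \<in> add_pow q (cspan (v u))"
  using assms mem_cspan_add_pow_iff[of "v u" q "v x"]
  by (simp add: add_pow_fm_def Let_def tm_val_tpow)

lemma (in oag) sat_chain_fm:
  assumes "v x \<in> carrier G" "v y \<in> carrier G" "p > 0"
  shows "sat G v (chain_fm p n x y) \<longleftrightarrow> (v x, v y) \<in> dom_rel p ^^ (2 ^ n)"
  using assms(1,2)
proof (induction n arbitrary: v x y)
  case 0
  then show ?case using assms(3) by (auto simp: dom_fm_def dom_rel_def sat_add_pow_fm)
next
  case (Suc n)
  \<comment> \<open>The quantifier of the formula ranges over the carrier, while relation
    composition does not. The exponent \<open>2 ^ n\<close> is positive, so \<open>c\<close> is the
    endpoint of an actual step.\<close>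
  have "c \<in> carrier G" if "(v x, c) \<in> dom_rel p ^^ (2 ^ n)" for c
  proof -
    have "(v x, c) \<in> (dom_rel p)\<^sup>+"
      using that by (simp add: relpow_add trancl_power) (metis zero_less_numeral zero_less_power)
    then show ?thesis by (induction) (auto simp: dom_rel_def)
  qed
  then show ?case
    using Suc by (auto simp: relpow_add mult_2)
qed

section \<open>Saturation and the inp-pattern\<close>

text \<open>Transitivity merges neighbouring steps in pairs, which halves the length of a
  chain.\<close>

lemma relpow_double_subset:
  assumes "trans R"
  shows "R ^^ (2 ^ Suc n) \<subseteq> R ^^ (2 ^ n)"
proof (induction n)
  case 0
  then show ?case using assms by (auto simp: numeral_2_eq_2 dest: transD)
next
  case (Suc n)
  have "R ^^ (2 ^ Suc (Suc n)) = R ^^ (2 ^ Suc n) O R ^^ (2 ^ Suc n)"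
    by (simp add: relpow_add[symmetric])
  also have "\<dots> \<subseteq> R ^^ (2 ^ n) O R ^^ (2 ^ n)"
    using Suc by (intro relcomp_mono)
  also have "\<dots> = R ^^ (2 ^ Suc n)"
    by (simp add: relpow_add[symmetric] mult_2)
  finally show ?case .
qed

text \<open>Among finitely many conditions on chain length, the longest therefore implies the
  others; this yields finite satisfiability of the types below.\<close>

lemma relpow_power2_mono:
  assumes "trans R" "(a, b) \<in> R ^^ (2 ^ n)" "m \<le> n"
  shows "(a, b) \<in> R ^^ (2 ^ m)"
  using assms(3,2)
proof (induction rule: dec_induct)
  case (step k)
  then show ?case using relpow_double_subset[OF assms(1)] by blast
qed

section \<open>Realizing countable types over finite sets\<close>

lemma finite_subset_range_bounded:
  fixes F :: "nat \<Rightarrow> 'b"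
  assumes "finite D" "D \<subseteq> range F"
  obtains N where "D \<subseteq> F ` {..<N}"
proof -
  obtain K where "finite K" "D = F ` K"
    using finite_subset_image[OF assms] by blast
  moreover then obtain N where "K \<subseteq> {..<N}"
    by (auto simp: finite_nat_set_iff_bounded)
  ultimately show ?thesis using that by blast
qed

text \<open>A finite parameter set is smaller than \<open>\<kappa>\<close>, so saturation applies,
  and every finite part of an enumerated type lies in an initial segment.\<close>

lemma monster_realizes:
  assumes "monster_model \<kappa> M T" "finite A" "A \<subseteq> carrier M"
    and over: "\<And>i. inst_over A n (F i)"
    and sat: "\<And>N :: nat. \<exists>xs. length xs = n \<and> set xs \<subseteq> carrier M \<and> realizes M xs (F ` {..N})"
  shows "\<exists>xs. length xs = n \<and> set xs \<subseteq> carrier M \<and> realizes M xs (range F)"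
proof -
  have "|A| <o natLeq" using assms(2) by (simp add: finite_iff_ordLess_natLeq)
  moreover have "natLeq <o \<kappa>" "saturated \<kappa> M"
    using assms(1) by (auto simp: monster_model_def)
  ultimately have "|A| <o \<kappa>" using ordLess_transitive by blast
  moreover have "consistent M n (range F)"
    unfolding consistent_def
  proof (intro allI impI)
    fix \<Delta> assume \<Delta>: "\<Delta> \<subseteq> range F \<and> finite \<Delta>"
    obtain N where "\<Delta> \<subseteq> F ` {..<N}"
      using finite_subset_range_bounded[OF conjunct2[OF \<Delta>] conjunct1[OF \<Delta>]] .
    then have "\<Delta> \<subseteq> F ` {..N}" by auto
    then show "\<exists>xs. length xs = n \<and> set xs \<subseteq> carrier M \<and> realizes M xs \<Delta>"
      using sat[of N] unfolding realizes_def by blast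
  qed
  ultimately show ?thesis
    using \<open>saturated \<kappa> M\<close> assms(3) over unfolding saturated_def by blast
qed

text \<open>Pairs joined by chains of unbounded finite length. As an intersection of definable
  relations it is type-definable, hence accessible to saturation.\<close>

definition (in oag) long_rel :: "nat \<Rightarrow> ('a \<times> 'a) set" where
  "long_rel p = (\<Inter>n. dom_rel p ^^ (2 ^ n))"

lemma (in oag) long_relD: "(a, b) \<in> long_rel p \<Longrightarrow> (a, b) \<in> dom_rel p ^^ (2 ^ n)"
  unfolding long_rel_def by blast

lemma (in oag) long_rel_dom_rel: "(a, b) \<in> long_rel p \<Longrightarrow> (a, b) \<in> dom_rel p"
  using long_relD[of a b p 0] by simp

text \<open>Density by compactness: the midpoint of a chain with \<open>2 ^ Suc N\<close> steps
  satisfies the conditions up to \<open>N\<close> towards both ends, and saturation gives one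
  midpoint for all lengths.\<close>

lemma (in oag) long_rel_interpolate:
  assumes mon: "monster_model \<kappa> G T" and p: "p > 0" and ab: "(a, b) \<in> long_rel p"
  shows "\<exists>c. (a, c) \<in> long_rel p \<and> (c, b) \<in> long_rel p"
proof -
  have abG: "a \<in> carrier G" "b \<in> carrier G"
    using long_rel_dom_rel[OF ab] by (auto simp: dom_rel_def)
  \<comment> \<open>Variable 0 is the element sought; the parameters \<open>a\<close> and
    \<open>b\<close> are variables 1 and 2.\<close>
  define F where "F n = (Conj (chain_fm p n 1 0) (chain_fm p n 0 2), [a, b])" for n
  have sat: "realizes G [c] (F ` N) \<longleftrightarrow>
      (\<forall>n\<in>N. (a, c) \<in> dom_rel p ^^ (2 ^ n) \<and> (c, b) \<in> dom_rel p ^^ (2 ^ n))"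
    if "c \<in> carrier G" for c N
    using that abG p by (simp add: realizes_def F_def sat_chain_fm)
  have "\<exists>xs. length xs = 1 \<and> set xs \<subseteq> carrier G \<and> realizes G xs (range F)"
  proof (rule monster_realizes[OF mon, of "{a, b}"])
    show "inst_over {a, b} 1 (F n)" for n
      using fv_chain_fm[of p n 1 0] fv_chain_fm[of p n 0 2] by (auto simp: F_def inst_over_def)
    fix N
    have "(a, b) \<in> dom_rel p ^^ (2 ^ Suc N)" using ab by (rule long_relD)
    then obtain c where c: "(a, c) \<in> dom_rel p ^^ (2 ^ N)" "(c, b) \<in> dom_rel p ^^ (2 ^ N)"
      by (auto simp: relpow_add mult_2)
    have cG: "c \<in> carrier G"
      using relpow_power2_mono[OF trans_dom_rel c(1), of 0] by (auto simp: dom_rel_def)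
    have "realizes G [c] (F ` {..N})"
      unfolding sat[OF cG] using c relpow_power2_mono[OF trans_dom_rel] by blast
    then show "\<exists>xs. length xs = 1 \<and> set xs \<subseteq> carrier G \<and> realizes G xs (F ` {..N})"
      using cG by (intro exI[of _ "[c]"]) simp
  qed (use abG in auto)
  then obtain c where c: "c \<in> carrier G" "realizes G [c] (range F)"
    by (auto simp: length_Suc_conv)
  then show ?thesis unfolding sat[OF c(1)] long_rel_def by blast
qed

lemma (in oag) long_rel_sequence:
  assumes mon: "monster_model \<kappa> G T" and p: "p > 0" and ab: "(a, b) \<in> long_rel p"
  shows "\<exists>c. c 0 = a \<and> (\<forall>j. (c j, c (Suc j)) \<in> long_rel p \<and> (c j, b) \<in> long_rel p)"
proof -
  \<comment> \<open>Each new term is interpolated between the current one and \<open>b\<close>. The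
    invariant that the current term is still \<open>long_rel\<close>-related to \<open>b\<close>
    keeps the process going.\<close>
  have "\<exists>c. \<forall>j::nat. ((c j, b) \<in> long_rel p \<and> (j = 0 \<longrightarrow> c j = a)) \<and>
      (c j, c (Suc j)) \<in> long_rel p"
    by (rule dependent_nat_choice) (use ab long_rel_interpolate[OF mon p] in blast)+
  then show ?thesis by blast
qed

section \<open>Lexicographic arrays\<close>

lemma (in oag) dom_rel_sequence:
  assumes "\<And>j. (c j, c (Suc j)) \<in> dom_rel p" "i \<le> j"
  shows "c i \<in> cspan (c j)"
  using assms(2)
proof (induction rule: dec_induct)
  case base
  then show ?case using cspan_self assms(1)[of i] by (auto simp: dom_rel_def)
next
  case (step k)
  have "cspan (c k) \<subseteq> cspan (c (Suc k))"
    using assms(1)[of k] dom_rel_cspan[OF assms(1)[of k]]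
    by (intro cspan_mono) (auto simp: dom_rel_def)
  then show ?case using step by blast
qed

text \<open>Interpolation is used twice: first for a sequence \<open>d\<close> below
  \<open>b\<close>, then for row \<open>i\<close> inside the gap from \<open>d i\<close> to
  \<open>d (Suc i)\<close>. Earlier rows thus lie below later ones entirely.\<close>

lemma (in oag) long_rel_array:
  assumes mon: "monster_model \<kappa> G T" and p: "p > 0" and ab: "(a, b) \<in> long_rel p"
  shows "\<exists>c. (\<forall>i j. (c i j, c i (Suc j)) \<in> dom_rel p) \<and>
    (\<forall>i i' j j'. i < (i' :: nat) \<longrightarrow> c i (j :: nat) \<in> cspan (c i' j'))"
proof -
  obtain d where d: "\<And>i. (d i, d (Suc i)) \<in> long_rel p"
    using long_rel_sequence[OF mon p ab] by blast
  have "\<forall>i. \<exists>c. c 0 = d i \<and>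
      (\<forall>j::nat. (c j, c (Suc j)) \<in> long_rel p \<and> (c j, d (Suc i)) \<in> long_rel p)"
    using long_rel_sequence[OF mon p d] by blast
  then obtain c where c0: "\<And>i. c i 0 = d i"
    and c: "\<And>i j::nat. (c i j, c i (Suc j)) \<in> long_rel p"
    and cd: "\<And>i j. (c i j, d (Suc i)) \<in> long_rel p"
    by metis
  have "c i j \<in> cspan (c i' j')" if "i < i'" for i i' j j'
  proof -
    have "c i j \<in> cspan (d (Suc i))"
      using cd by (intro dom_rel_cspan long_rel_dom_rel)
    moreover have "d (Suc i) \<in> cspan (d i')"
      using that d by (intro dom_rel_sequence[where c = d and p = p] long_rel_dom_rel) auto
    moreover have "c i' 0 \<in> cspan (c i' j')"
      using c by (intro dom_rel_sequence[where c = "c i'" and p = p] long_rel_dom_rel) auto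
    moreover have "d k \<in> carrier G \<and> \<one> \<preceq> d k" "c i' k \<in> carrier G \<and> \<one> \<preceq> c i' k" for k
      using long_rel_dom_rel[OF d[of k]] long_rel_dom_rel[OF c[of i' k]]
      by (auto simp: dom_rel_def)
    ultimately show ?thesis
      using cspan_mono[of "d i'" "d (Suc i)"] cspan_mono[of "c i' j'" "c i' 0"] c0[of i'] by auto
  qed
  then show ?thesis using c long_rel_dom_rel by blast
qed

text \<open>The exponent grows with the row so that \<open>independent_rows\<close> can satisfy one
  formula from each row simultaneously. Within a row, consecutive elements bound disjoint steps of
  an increasing sequence of sets \<open>B(c) + qG\<close>.\<close>

lemma (in oag) array_inp_pattern:
  assumes p: "p > 0"
    and c: "\<And>i j. (c i j, c i (Suc j)) \<in> dom_rel p"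
    and rows: "\<And>i i' j j'. i < i' \<Longrightarrow> c i j \<in> cspan (c i' j')"
  shows "inp_pattern G 1 (trivial_type 1) (UNIV :: nat set) (UNIV :: nat set) {(i, j). i \<le> j}
    (\<lambda>_. 2) (\<lambda>i. Conj (add_pow_fm (p ^ Suc i) 0 2) (Neg (add_pow_fm (p ^ Suc i) 0 1)))
    (\<lambda>_. 2) (\<lambda>i j. [c i j, c i (Suc j)])"
  (is "inp_pattern G 1 _ _ _ _ _ ?\<phi> _ ?a")
proof -
  have cG: "c i j \<in> carrier G" "\<one> \<preceq> c i j" for i j
    using c[of i j] by (auto simp: dom_rel_def)
  have lin: "linear_order_on (UNIV :: nat set) {(i, j). i \<le> j}"
    by (auto simp: linear_order_on_def partial_order_on_def preorder_on_def
        refl_on_def trans_def antisym_def total_on_def)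
  have fv: "fv (?\<phi> i) \<subseteq> {..<1 + 2}" for i
    using fv_add_pow_fm[of "p ^ Suc i" 0 2] fv_add_pow_fm[of "p ^ Suc i" 0 1] by auto
  have sat: "sat G (nth ([x] @ ?a i j)) (?\<phi> i) \<longleftrightarrow>
      x \<in> add_pow (p ^ Suc i) (cspan (c i (Suc j))) \<and> x \<notin> add_pow (p ^ Suc i) (cspan (c i j))"
    if "x \<in> carrier G" for x i j
    using that cG p by (simp add: sat_add_pow_fm del: power_Suc)
  have con: "consistent G 1 (trivial_type 1 \<union> range (\<lambda>i. (?\<phi> i, ?a i (f i))))" for f
    unfolding consistent_def
  proof (intro allI impI)
    fix \<Delta>
    let ?F = "\<lambda>i. (?\<phi> i, ?a i (f i))"
    assume \<Delta>: "\<Delta> \<subseteq> trivial_type 1 \<union> range ?F \<and> finite \<Delta>"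
    then have "finite (\<Delta> - trivial_type 1)" "\<Delta> - trivial_type 1 \<subseteq> range ?F" by auto
    \<comment> \<open>Consistency concerns finite parts only, so a witness for the first
      \<open>N\<close> rows suffices for the given \<open>\<Delta>\<close>.\<close>
    then obtain N where "\<Delta> - trivial_type 1 \<subseteq> ?F ` {..<N}"
      by (rule finite_subset_range_bounded)
    moreover obtain x where x: "x \<in> carrier G"
      and "\<forall>i<N. x \<in> add_pow (p ^ Suc i) (cspan (c i (Suc (f i)))) \<and>
                 x \<notin> add_pow (p ^ Suc i) (cspan (c i (f i)))"
      using independent_rows[OF p, of "\<lambda>i. c i (f i)" "\<lambda>i. c i (Suc (f i))" N] c rows by blast
    then have "realizes G [x] (?F ` {..<N})"
      unfolding realizes_def using sat[OF x] by auto
    moreover have "realizes G [x] (trivial_type 1)"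
      unfolding realizes_def trivial_type_def by auto
    ultimately have "realizes G [x] \<Delta>"
      unfolding realizes_def by blast
    then show "\<exists>xs. length xs = 1 \<and> set xs \<subseteq> carrier G \<and> realizes G xs \<Delta>"
      using x by (intro exI[of _ "[x]"]) simp
  qed
  have inc: "\<not> consistent G 1 ((\<lambda>j. (?\<phi> i, ?a i j)) ` J)" if J: "finite J" "card J = 2" for i J
  proof
    assume "consistent G 1 ((\<lambda>j. (?\<phi> i, ?a i j)) ` J)"
    then obtain x where x: "x \<in> carrier G" and "realizes G [x] ((\<lambda>j. (?\<phi> i, ?a i j)) ` J)"
      using \<open>finite J\<close> unfolding consistent_def by (auto simp: length_Suc_conv)
    then have xJ: "x \<in> add_pow (p ^ Suc i) (cspan (c i (Suc j)))"
      "x \<notin> add_pow (p ^ Suc i) (cspan (c i j))" if "j \<in> J" for j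
      using that sat[OF x] unfolding realizes_def by blast+
    \<comment> \<open>For \<open>s < t\<close>, the positive condition at column \<open>s\<close>
      contradicts the negative condition at column \<open>t\<close>.\<close>
    obtain s t where st: "s \<in> J" "t \<in> J" "s < t"
      using J(2) by (metis card_2_iff insertCI linorder_neqE_nat)
    have "c i (Suc s) \<in> cspan (c i t)"
      using dom_rel_sequence[of "c i", OF c] st(3) by simp
    then have "add_pow (p ^ Suc i) (cspan (c i (Suc s))) \<subseteq> add_pow (p ^ Suc i) (cspan (c i t))"
      using cG by (intro add_pow_mono cspan_mono)
    then show False using xJ st by blast
  qed
  show ?thesis
    unfolding inp_pattern_def using lin fv con inc cG by auto
qed

theorem theorem6p2:
  fixes G :: "'g ord_monoid" and M :: "'m ord_monoid" and \<kappa> :: "'k rel"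
  assumes "oag G"
    and "monster_model \<kappa> M (Th G)"
    and "strong M"
  shows "bounded_regular_rank G"
proof (rule ccontr)
  assume "\<not> bounded_regular_rank G"
  then obtain p where "prime p" and inf: "infinite (RJ p G)"
    unfolding bounded_regular_rank_def by blast
  then have p: "p > 0" using prime_gt_0_nat by blast
  interpret G: oag G by fact
  have M: "models M (Th G)" using assms(2) by (simp add: monster_model_def)
  then interpret M: oag M by (simp add: models_def)
  have chains: "\<exists>a b. a \<in> carrier M \<and> b \<in> carrier M \<and> (a, b) \<in> M.dom_rel p ^^ (2 ^ n)" for n
  proof -
    \<comment> \<open>Existence of a chain of fixed length is a single sentence, so it passes from
      \<open>G\<close> to \<open>M\<close> through \<open>Th G\<close>.\<close>
    let ?\<psi> = "Exi 0 (Exi 1 (chain_fm p n 0 1))"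
    obtain a b where ab: "(a, b) \<in> G.dom_rel p ^^ (2 ^ n)"
      using G.RJ_infinite_imp_chain[OF p inf] by blast
    then have "(a, b) \<in> G.dom_rel p"
      using relpow_power2_mono[OF G.trans_dom_rel ab, of 0] by simp
    then have "a \<in> carrier G" "b \<in> carrier G" by (auto simp: G.dom_rel_def)
    then have "sentence_true G ?\<psi>"
      using ab p unfolding sentence_true_def by (auto simp: G.sat_chain_fm)
    moreover have "fv ?\<psi> = {}" using fv_chain_fm[of p n 0 1] by auto
    ultimately have "sentence_true M ?\<psi>"
      using M by (simp add: models_def Th_def)
    then have "sat M (\<lambda>_. \<one>\<^bsub>M\<^esub>) ?\<psi>" unfolding sentence_true_def by auto
    then show ?thesis using p by (auto simp: M.sat_chain_fm)
  qed
  have sat: "realizes M [a, b] ((\<lambda>n. (chain_fm p n 0 1, [])) ` N) \<longleftrightarrow>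
      (\<forall>n\<in>N. (a, b) \<in> M.dom_rel p ^^ (2 ^ n))"
    if "a \<in> carrier M" "b \<in> carrier M" for a b N
    using that p by (simp add: realizes_def M.sat_chain_fm)
  \<comment> \<open>One pair must serve all lengths at once. The type in two variables that says so
    has no parameters, and each finite part follows from its longest chain.\<close>
  have "\<exists>xs. length xs = 2 \<and> set xs \<subseteq> carrier M \<and>
      realizes M xs (range (\<lambda>n. (chain_fm p n 0 1, [])))"
  proof (rule monster_realizes[OF assms(2), of "{}"])
    show "inst_over {} 2 (chain_fm p n 0 1, [])" for n
      using fv_chain_fm[of p n 0 1] by (auto simp: inst_over_def)
    fix N
    obtain a b where ab: "a \<in> carrier M" "b \<in> carrier M" "(a, b) \<in> M.dom_rel p ^^ (2 ^ N)"
      using chains by blast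
    then have "realizes M [a, b] ((\<lambda>n. (chain_fm p n 0 1, [])) ` {..N})"
      unfolding sat[OF ab(1,2)] using ab(3) relpow_power2_mono[OF M.trans_dom_rel] by blast
    then show "\<exists>xs. length xs = 2 \<and> set xs \<subseteq> carrier M \<and>
        realizes M xs ((\<lambda>n. (chain_fm p n 0 1, [])) ` {..N})"
      using ab by (intro exI[of _ "[a, b]"]) simp
  qed auto
  then obtain a b where "a \<in> carrier M" "b \<in> carrier M"
    "realizes M [a, b] (range (\<lambda>n. (chain_fm p n 0 1, [])))"
    by (auto simp: length_Suc_conv numeral_2_eq_2)
  then have "(a, b) \<in> M.long_rel p" using sat unfolding M.long_rel_def by blast
  then obtain c :: "nat \<Rightarrow> nat \<Rightarrow> 'm" where "\<And>i j. (c i j, c i (Suc j)) \<in> M.dom_rel p"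
    "\<And>i i' j j'. i < i' \<Longrightarrow> c i j \<in> M.cspan (c i' j')"
    using M.long_rel_array[OF assms(2) p] by metis
  from M.array_inp_pattern[where c = c, OF p this] show False
    using strong_imp_no_inp_pattern[OF assms(3) infinite_UNIV_nat] by blast
qed

end
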